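(* Let $k\in\mathbb N$ be such that $\tilde K^\gamma_{>k}$ is positive definite, and let $\rho_{k,n}$ be the concentration coefficient. Then $$V\le\sigma_\varepsilon^2\,\rho_{k,n}^2\left(\frac{\sum_{j=1}^n\sum_{i\le k}p_i^{-2}\lambda_i^{-\beta'}\psi_i(x_j)^2}{\mu_k(\Psi_{\le k}^{\top}\Psi_{\le k})^2}+\frac{\sum_{j=1}^n\sum_{i>k}p_i^{2}\lambda_i^{2\beta-\beta'}\psi_i(x_j)^2}{n^2\,\big(\sup_{i>k}p_i^2\lambda_i^\beta\big)^2}\right).$$
   Context: Setting. $x_1,\dots,x_n$ are i.i.d. from a probability measure $\rho_{\mathcal X}$ on $\mathcal X$. $\mathcal H$ is a separable reproducing kernel Hilbert space on $\mathcal X$ with kernel $K(s,t)=\sum_{i\ge1}\lambda_i\psi_i(s)\psi_i(t)$, where $\lambda_i>0$ and $(\psi_i)$ is an orthonormal basis of $L^2(\rho_{\mathcal X})$; $\lambda_i\propto i^{-\lambda}$ with $\lambda>1$. For $s\ge0$, $\mathcal H^s=\{\sum_i a_i\lambda_i^{s/2}\psi_i:\sum_i a_i^2<\infty\}$ with norm $\|\sum_i a_i\lambda_i^{s/2}\psi_i\|_{\mathcal H^s}=(\sum_i a_i^2)^{1/2}$. Fix $\beta\in[0,1]$ and $\beta'\in[0,\beta]$. $\mathcal A$ is the self-adjoint operator with $\mathcal A\psi_i=p_i\psi_i$, $p_i\propto i^{-p}$, $p<0$. The regularization parameter is $\gamma_n\ge0$. Notation. $\Psi_{\le k}\in\mathbb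 R^{n\times k}$ has entries $(\Psi_{\le k})_{ji}=\psi_i(x_j)$. $\tilde K_{jl}=\sum_{i\ge1}p_i^2\lambda_i^\beta\psi_i(x_j)\psi_i(x_l)$ and $(\tilde K_{>k})_{jl}=\sum_{i>k}p_i^2\lambda_i^\beta\psi_i(x_j)\psi_i(x_l)$ (assumed to converge), $\tilde K^\gamma=\tilde K+n\gamma_nI$, $\tilde K^\gamma_{>k}=\tilde K_{>k}+n\gamma_nI$, all in $\mathbb R^{n\times n}$. $\mu_i(M)$ is the $i$-th largest eigenvalue of $M$. Fractions with zero denominator are read as $+\infty$. Variance: $V=\mathbb E_\varepsilon\|\hat f(\varepsilon)\|_{\mathcal H^{\beta'}}^2$, where $\varepsilon\in\mathbb R^n$ is the noise vector, with centred i.i.d. entries of variance $\sigma_\varepsilon^2$, independent of the $x_j$, and for $v\in\mathbb R^n$, $\hat f(v)=\sum_{i\ge1}p_i\lambda_i^{\beta}\big(\sum_{j=1}^n\theta_j\psi_i(x_j)\big)\psi_i$ with $\theta=(\tilde K^\gamma)^{-1}v$. Concentration coefficient: $\rho_{k,n}=\dfrac{\sup_{i>k}p_i^2\lambda_i^\beta+\mu_1(\frac1n\tilde K_{>k})+\gamma_n}{\mu_n(\frac1n\tilde K_{>k})+\gamma_n}$. *)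

theory Defs
  imports "HOL-Probability.Probability" "Jordan_Normal_Form.Gauss_Jordan_Elimination"
    "Jordan_Normal_Form.Char_Poly"
begin

text \<open>Sequences carrying the paper's index \<open>i \<ge> 1\<close> are functions on \<^typ>\<open>nat\<close> whose value at
  \<open>0\<close> is never used; sample points and matrix entries are indexed from \<open>0\<close>.\<close>

subsection \<open>The space \<open>L\<^sup>2(\<rho>)\<close>\<close>

text \<open>Elements of \<open>L\<^sup>2(\<rho>)\<close> are represented by functions; equality in \<open>L\<^sup>2(\<rho>)\<close> is equality almost
  everywhere.\<close>

definition L2 :: "'x measure \<Rightarrow> ('x \<Rightarrow> real) set" where
  "L2 \<rho> = {f \<in> borel_measurable \<rho>. integrable \<rho> (\<lambda>x. (f x)\<^sup>2)}"

definition L2_inner :: "'x measure \<Rightarrow> ('x \<Rightarrow> real) \<Rightarrow> ('x \<Rightarrow> real) \<Rightarrow> real" where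
  "L2_inner \<rho> f g = (\<integral>x. f x * g x \<partial>\<rho>)"

text \<open>\<open>f = \<Sum>\<^sub>i\<^sub>\<ge>\<^sub>1 u\<^sub>i\<close> with convergence in \<open>L\<^sup>2(\<rho>)\<close>.\<close>

definition L2_sums :: "'x measure \<Rightarrow> (nat \<Rightarrow> 'x \<Rightarrow> real) \<Rightarrow> ('x \<Rightarrow> real) \<Rightarrow> bool" where
  "L2_sums \<rho> u f \<longleftrightarrow> f \<in> L2 \<rho> \<and> (\<forall>i\<ge>1. u i \<in> L2 \<rho>) \<and>
     (\<lambda>N. \<integral>x. (f x - (\<Sum>i=1..N. u i x))\<^sup>2 \<partial>\<rho>) \<longlonglongrightarrow> 0"

text \<open>A representative of the sum; it is determined up to a null set when the series converges.\<close>

definition L2_suminf :: "'x measure \<Rightarrow> (nat \<Rightarrow> 'x \<Rightarrow> real) \<Rightarrow> 'x \<Rightarrow> real" where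
  "L2_suminf \<rho> u = (SOME f. L2_sums \<rho> u f)"

definition L2_orthonormal_basis :: "'x measure \<Rightarrow> (nat \<Rightarrow> 'x \<Rightarrow> real) \<Rightarrow> bool" where
  "L2_orthonormal_basis \<rho> \<psi> \<longleftrightarrow>
     (\<forall>i\<ge>1. \<psi> i \<in> L2 \<rho>) \<and>
     (\<forall>i\<ge>1. \<forall>j\<ge>1. L2_inner \<rho> (\<psi> i) (\<psi> j) = (if i = j then 1 else 0)) \<and>
     (\<forall>f\<in>L2 \<rho>. L2_sums \<rho> (\<lambda>i x. L2_inner \<rho> f (\<psi> i) * \<psi> i x) f)"

text \<open>A possibly unbounded self-adjoint operator on \<open>L\<^sup>2(\<rho>)\<close> with domain \<open>D\<close>: densely defined, linear,
  symmetric, and such that the domain of the adjoint is contained in \<open>D\<close>.\<close>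

definition self_adjoint_L2 ::
  "'x measure \<Rightarrow> ('x \<Rightarrow> real) set \<Rightarrow> (('x \<Rightarrow> real) \<Rightarrow> 'x \<Rightarrow> real) \<Rightarrow> bool" where
  "self_adjoint_L2 \<rho> D A \<longleftrightarrow>
     D \<subseteq> L2 \<rho> \<and> A ` D \<subseteq> L2 \<rho> \<and>
     (\<forall>f\<in>L2 \<rho>. \<forall>e>0. \<exists>g\<in>D. (\<integral>x. (f x - g x)\<^sup>2 \<partial>\<rho>) < e) \<and>
     (\<forall>f\<in>D. \<forall>g\<in>D. \<forall>a b. (\<lambda>x. a * f x + b * g x) \<in> D \<and>
        (AE x in \<rho>. A (\<lambda>x. a * f x + b * g x) x = a * A f x + b * A g x)) \<and>
     (\<forall>f\<in>D. \<forall>g\<in>D. L2_inner \<rho> (A f) g = L2_inner \<rho> f (A g)) \<and>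
     (\<forall>g\<in>L2 \<rho>. (\<exists>h\<in>L2 \<rho>. \<forall>f\<in>D. L2_inner \<rho> (A f) g = L2_inner \<rho> f h) \<longrightarrow> g \<in> D)"

subsection \<open>Reproducing kernel Hilbert spaces and the spaces \<open>H\<^sup>s\<close>\<close>

text \<open>The Hilbert space is a type \<open>'h\<close>; \<open>evl h\<close> is the function on \<open>S\<close> that \<open>h\<close> stands for, so the
  first three conditions say that \<open>'h\<close> is a linear space of functions on \<open>S\<close>.  The last one is the
  reproducing property, \<open>\<kappa> x\<close> being the section \<open>K(\<cdot>, x)\<close>.\<close>

definition is_rkhs ::
  "('h::{real_inner, complete_space} \<Rightarrow> 'x \<Rightarrow> real) \<Rightarrow> 'x set \<Rightarrow> ('x \<Rightarrow> 'x \<Rightarrow> real) \<Rightarrow> bool" where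
  "is_rkhs evl S K \<longleftrightarrow>
     (\<forall>f g. \<forall>x\<in>S. evl (f + g) x = evl f x + evl g x) \<and>
     (\<forall>c f. \<forall>x\<in>S. evl (c *\<^sub>R f) x = c * evl f x) \<and>
     (\<forall>f g. (\<forall>x\<in>S. evl f x = evl g x) \<longrightarrow> f = g) \<and>
     (\<exists>\<kappa>. \<forall>x\<in>S. (\<forall>s\<in>S. evl (\<kappa> x) s = K s x) \<and> (\<forall>f. evl f x = inner f (\<kappa> x)))"

definition Hs_coeffs ::
  "'x measure \<Rightarrow> (nat \<Rightarrow> real) \<Rightarrow> (nat \<Rightarrow> 'x \<Rightarrow> real) \<Rightarrow> real \<Rightarrow> ('x \<Rightarrow> real) \<Rightarrow> (nat \<Rightarrow> real) \<Rightarrow> bool" where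
  "Hs_coeffs \<rho> lam \<psi> s f a \<longleftrightarrow>
     summable (\<lambda>i. (a (Suc i))\<^sup>2) \<and> L2_sums \<rho> (\<lambda>i x. a i * lam i powr (s / 2) * \<psi> i x) f"

definition Hs :: "'x measure \<Rightarrow> (nat \<Rightarrow> real) \<Rightarrow> (nat \<Rightarrow> 'x \<Rightarrow> real) \<Rightarrow> real \<Rightarrow> ('x \<Rightarrow> real) set" where
  "Hs \<rho> lam \<psi> s = {f. \<exists>a. Hs_coeffs \<rho> lam \<psi> s f a}"

text \<open>The extended norm: \<open>\<infinity>\<close> outside \<open>H\<^sup>s\<close>.\<close>

definition Hs_norm ::
  "'x measure \<Rightarrow> (nat \<Rightarrow> real) \<Rightarrow> (nat \<Rightarrow> 'x \<Rightarrow> real) \<Rightarrow> real \<Rightarrow> ('x \<Rightarrow> real) \<Rightarrow> ennreal" where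
  "Hs_norm \<rho> lam \<psi> s f =
     (if f \<in> Hs \<rho> lam \<psi> s
      then ennreal (THE r. \<exists>a. Hs_coeffs \<rho> lam \<psi> s f a \<and> r = sqrt (\<Sum>i. (a (Suc i))\<^sup>2))
      else \<infinity>)"

subsection \<open>Matrices\<close>

text \<open>The \<open>i\<close>-th largest eigenvalue, \<open>1 \<le> i \<le> n\<close>, of a symmetric real \<open>n \<times> n\<close> matrix, eigenvalues
  being counted with multiplicity.\<close>

definition eig :: "nat \<Rightarrow> real mat \<Rightarrow> real" where
  "eig i A = rev (sorted_list_of_multiset (proots (char_poly A))) ! (i - 1)"

definition pos_def :: "nat \<Rightarrow> real mat \<Rightarrow> bool" where
  "pos_def n A \<longleftrightarrow> A \<in> carrier_mat n n \<and> transpose_mat A = A \<and>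
     (\<forall>v\<in>carrier_vec n. v \<noteq> 0\<^sub>v n \<longrightarrow> scalar_prod v (A *\<^sub>v v) > 0)"

text \<open>\<open>\<Psi>\<^sub>\<le>\<^sub>k\<close>: column \<open>c\<close> belongs to \<open>\<psi>\<^sub>c\<^sub>+\<^sub>1\<close>.\<close>

definition Psi_le :: "(nat \<Rightarrow> 'x \<Rightarrow> real) \<Rightarrow> nat \<Rightarrow> nat \<Rightarrow> (nat \<Rightarrow> 'x) \<Rightarrow> real mat" where
  "Psi_le \<psi> n k x = Matrix.mat n k (\<lambda>(j, c). \<psi> (Suc c) (x j))"

text \<open>The matrix with entries \<open>\<Sum>\<^sub>i\<^sub>>\<^sub>k p\<^sub>i\<^sup>2 \<lambda>\<^sub>i\<^sup>\<beta> \<psi>\<^sub>i(x\<^sub>j) \<psi>\<^sub>i(x\<^sub>l)\<close>; \<open>k = 0\<close> gives the full matrix.\<close>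

definition K_tail :: "(nat \<Rightarrow> real) \<Rightarrow> (nat \<Rightarrow> real) \<Rightarrow> (nat \<Rightarrow> 'x \<Rightarrow> real) \<Rightarrow> real \<Rightarrow>
    nat \<Rightarrow> nat \<Rightarrow> (nat \<Rightarrow> 'x) \<Rightarrow> real mat" where
  "K_tail p lam \<psi> \<beta> n k x = Matrix.mat n n (\<lambda>(j, l).
     \<Sum>m. (let i = k + Suc m in (p i)\<^sup>2 * lam i powr \<beta> * \<psi> i (x j) * \<psi> i (x l)))"

definition K_tail_reg :: "(nat \<Rightarrow> real) \<Rightarrow> (nat \<Rightarrow> real) \<Rightarrow> (nat \<Rightarrow> 'x \<Rightarrow> real) \<Rightarrow> real \<Rightarrow> real \<Rightarrow>
    nat \<Rightarrow> nat \<Rightarrow> (nat \<Rightarrow> 'x) \<Rightarrow> real mat" where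
  "K_tail_reg p lam \<psi> \<beta> \<gamma> n k x = K_tail p lam \<psi> \<beta> n k x + (real n * \<gamma>) \<cdot>\<^sub>m 1\<^sub>m n"

subsection \<open>Estimator, variance and concentration coefficient\<close>

definition fhat :: "'x measure \<Rightarrow> (nat \<Rightarrow> real) \<Rightarrow> (nat \<Rightarrow> real) \<Rightarrow> (nat \<Rightarrow> 'x \<Rightarrow> real) \<Rightarrow> real \<Rightarrow> real \<Rightarrow>
    nat \<Rightarrow> (nat \<Rightarrow> 'x) \<Rightarrow> real vec \<Rightarrow> 'x \<Rightarrow> real" where
  "fhat \<rho> p lam \<psi> \<beta> \<gamma> n x v =
     (let \<theta> = the (mat_inverse (K_tail_reg p lam \<psi> \<beta> \<gamma> n 0 x)) *\<^sub>v v
      in L2_suminf \<rho> (\<lambda>i s. p i * lam i powr \<beta> * (\<Sum>j<n. vec_index \<theta> j * \<psi> i (x j)) * \<psi> i s))"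

text \<open>The expectation over the noise \<open>\<epsilon>\<close>, living on the probability space \<open>M\<close>, with the sample
  points \<open>x\<close> held fixed.\<close>

definition variance_term :: "'w measure \<Rightarrow> (nat \<Rightarrow> 'w \<Rightarrow> real) \<Rightarrow> 'x measure \<Rightarrow> (nat \<Rightarrow> real) \<Rightarrow>
    (nat \<Rightarrow> real) \<Rightarrow> (nat \<Rightarrow> 'x \<Rightarrow> real) \<Rightarrow> real \<Rightarrow> real \<Rightarrow> real \<Rightarrow> nat \<Rightarrow> (nat \<Rightarrow> 'x) \<Rightarrow> ennreal" where
  "variance_term M eps \<rho> p lam \<psi> \<beta> \<beta>' \<gamma> n x =
     (\<integral>\<^sup>+ w. (Hs_norm \<rho> lam \<psi> \<beta>'
        (fhat \<rho> p lam \<psi> \<beta> \<gamma> n x (Matrix.vec n (\<lambda>j. eps j w))))\<^sup>2 \<partial>M)"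

text \<open>Fractions with zero denominator are \<open>\<infinity>\<close>, whereas \<open>0 / 0 = 0\<close> in \<^typ>\<open>ennreal\<close>.\<close>

definition frac_inf :: "ennreal \<Rightarrow> ennreal \<Rightarrow> ennreal" where
  "frac_inf a b = (if b = 0 then \<infinity> else a / b)"

definition sup_tail :: "(nat \<Rightarrow> real) \<Rightarrow> (nat \<Rightarrow> real) \<Rightarrow> real \<Rightarrow> nat \<Rightarrow> ennreal" where
  "sup_tail p lam \<beta> k = (SUP i\<in>{k<..}. ennreal ((p i)\<^sup>2 * lam i powr \<beta>))"

definition rho_coeff :: "(nat \<Rightarrow> real) \<Rightarrow> (nat \<Rightarrow> real) \<Rightarrow> (nat \<Rightarrow> 'x \<Rightarrow> real) \<Rightarrow> real \<Rightarrow> real \<Rightarrow>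
    nat \<Rightarrow> nat \<Rightarrow> (nat \<Rightarrow> 'x) \<Rightarrow> ennreal" where
  "rho_coeff p lam \<psi> \<beta> \<gamma> n k x =
     (let B = (1 / real n) \<cdot>\<^sub>m K_tail p lam \<psi> \<beta> n k x
      in frac_inf (sup_tail p lam \<beta> k + ennreal (eig 1 B) + ennreal \<gamma>) (ennreal (eig n B + \<gamma>)))"

end

theory Submission
  imports Defs
begin

text \<open>Let \<open>q\<^sub>i\<close> be the vector \<open>(\<psi>\<^sub>i(x\<^sub>j))\<^sub>j\<close> and \<open>w\<^sub>i = K\<^sup>-\<^sup>1 q\<^sub>i\<close> with \<open>K\<close> the full regularised matrix. Expanding
  the norm in the basis and using that the noise is uncorrelated, the variance is
  \<open>\<sigma>\<^sup>2 \<Sum>\<^sub>i p\<^sub>i\<^sup>2 \<lambda>\<^sub>i\<^sup>2\<^sup>\<beta>\<^sup>-\<^sup>\<beta>\<^sup>' \<bar>w\<^sub>i\<bar>\<^sup>2\<close>. Let \<open>m\<close> and \<open>L\<close> be the extreme eigenvalues of the regularised tail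
  matrix \<open>A\<close>. For \<open>i > k\<close>, \<open>K \<ge> A \<ge> m\<close> gives \<open>\<bar>w\<^sub>i\<bar> \<le> \<bar>q\<^sub>i\<bar> / m\<close>. For \<open>i \<le> k\<close> an energy estimate replaces the
  Woodbury identity: it gives \<open>\<bar>w\<^sub>i\<bar>\<^sup>2 \<le> L / (m \<mu> d\<^sub>i\<^sup>2)\<close>, where \<open>d\<^sub>i = p\<^sub>i\<^sup>2 \<lambda>\<^sub>i\<^sup>\<beta>\<close> and \<open>\<mu>\<close> is the \<open>k\<close>-th eigenvalue
  of the Gram matrix, and \<open>\<mu> \<le> \<bar>q\<^sub>i\<bar>\<^sup>2\<close> turns this into the first fraction. When one of the quantities
  is infinite or \<open>\<mu> = 0\<close>, the right-hand side is infinite unless \<open>\<sigma> = 0\<close>.\<close>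

section \<open>Extreme eigenvalues of real symmetric matrices\<close>

text \<open>Vectors are functions on \<open>nat\<close> of which only the first \<open>n\<close>
  values count. As points of a product space they make compactness available through Tychonoff's
  theorem.\<close>

definition dot :: "nat \<Rightarrow> (nat \<Rightarrow> real) \<Rightarrow> (nat \<Rightarrow> real) \<Rightarrow> real" where
  "dot n x y = (\<Sum>i<n. x i * y i)"

definition app :: "nat \<Rightarrow> (nat \<Rightarrow> nat \<Rightarrow> real) \<Rightarrow> (nat \<Rightarrow> real) \<Rightarrow> nat \<Rightarrow> real" where
  "app n a x = (\<lambda>i. \<Sum>j<n. a i j * x j)"

definition symm :: "nat \<Rightarrow> (nat \<Rightarrow> nat \<Rightarrow> real) \<Rightarrow> bool" where
  "symm n a \<longleftrightarrow> (\<forall>i<n. \<forall>j<n. a i j = a j i)"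

lemma dot_commute: "dot n x y = dot n y x"
  by (simp add: dot_def mult.commute)

lemma dot_add_left: "dot n (\<lambda>i. x i + y i) z = dot n x z + dot n y z"
  by (simp add: dot_def algebra_simps sum.distrib)

lemma dot_add_right: "dot n z (\<lambda>i. x i + y i) = dot n z x + dot n z y"
  by (simp add: dot_def algebra_simps sum.distrib)

lemma dot_scale_left: "dot n (\<lambda>i. c * x i) z = c * dot n x z"
  by (simp add: dot_def algebra_simps sum_distrib_left)

lemma dot_scale_right: "dot n z (\<lambda>i. c * x i) = c * dot n z x"
  by (simp add: dot_def algebra_simps sum_distrib_left)

lemma dot_self: "dot n x x = (\<Sum>i<n. (x i)\<^sup>2)"
  by (simp add: dot_def power2_eq_square)

lemma dot_self_nonneg [simp]: "0 \<le> dot n x x"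
  by (simp add: dot_self sum_nonneg)

lemma dot_self_eq_0_iff: "dot n x x = 0 \<longleftrightarrow> (\<forall>i<n. x i = 0)"
  by (auto simp add: dot_self sum_nonneg_eq_0_iff)

lemma dot_cong: "(\<And>i. i < n \<Longrightarrow> x i = x' i) \<Longrightarrow> (\<And>i. i < n \<Longrightarrow> y i = y' i) \<Longrightarrow> dot n x y = dot n x' y'"
  by (simp add: dot_def)

lemma dot_Cauchy_Schwarz: "(dot n x y)\<^sup>2 \<le> dot n x x * dot n y y"
  using Cauchy_Schwarz_ineq_sum[of x y "{..<n}"] by (simp add: dot_def power2_eq_square)

lemma app_add: "app n a (\<lambda>i. x i + y i) = (\<lambda>i. app n a x i + app n a y i)"
  by (simp add: app_def algebra_simps sum.distrib)

lemma app_scale: "app n a (\<lambda>i. c * x i) = (\<lambda>i. c * app n a x i)"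
  by (simp add: app_def algebra_simps sum_distrib_left)

lemma dot_app_symm:
  assumes "symm n a"
  shows "dot n x (app n a y) = dot n (app n a x) y"
proof -
  have "dot n x (app n a y) = (\<Sum>i<n. \<Sum>j<n. a i j * x i * y j)"
    by (simp add: dot_def app_def sum_distrib_left mult_ac)
  also have "\<dots> = (\<Sum>j<n. \<Sum>i<n. a i j * x i * y j)"
    by (rule sum.swap)
  also have "\<dots> = (\<Sum>j<n. \<Sum>i<n. a j i * x i * y j)"
    using assms by (intro sum.cong refl) (simp add: symm_def)
  also have "\<dots> = dot n (app n a x) y"
    by (simp add: dot_def app_def sum_distrib_right sum_distrib_left mult_ac)
  finally show ?thesis .
qed

text \<open>The choice \<open>t = - b / a\<close> minimises the quadratic when \<open>a\<close> is
  positive; for \<open>a = 0\<close> a linear function bounded below has slope zero.\<close>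

lemma nonneg_quadratic_discriminant:
  fixes a b c :: real
  assumes "\<And>t. 0 \<le> c + 2 * t * b + t\<^sup>2 * a" and "0 \<le> a"
  shows "b\<^sup>2 \<le> c * a"
proof (cases "a = 0")
  case True
  have "b = 0"
  proof (rule ccontr)
    assume "b \<noteq> 0"
    \<comment> \<open>At \<open>t = - (c + 1) / (2 * b)\<close> the linear function takes the value
      \<open>-1\<close>.\<close>
    then show False
      using assms(1)[of "- (c + 1) / (2 * b)"] True assms(1)[of 0] by (simp add: field_simps)
  qed
  then show ?thesis using True by simp
next
  case False
  then show ?thesis
    using assms(1)[of "- b / a"] assms(2) by (simp add: field_simps power2_eq_square)
qed

text \<open>Along the line through \<open>x\<close> in direction \<open>y\<close> the form is a
  nonnegative quadratic in \<open>t\<close>. The form may be degenerate, which is what makes a zero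
  of it a kernel vector later on.\<close>

lemma psd_Cauchy_Schwarz:
  assumes "symm n a" and "\<And>x. 0 \<le> dot n x (app n a x)"
  shows "(dot n x (app n a y))\<^sup>2 \<le> dot n x (app n a x) * dot n y (app n a y)"
proof (rule nonneg_quadratic_discriminant)
  fix t
  have "dot n y (app n a x) = dot n x (app n a y)"
    using dot_app_symm[OF assms(1)] dot_commute by metis
  then have "dot n (\<lambda>i. x i + t * y i) (app n a (\<lambda>i. x i + t * y i)) =
      dot n x (app n a x) + 2 * t * dot n x (app n a y) + t\<^sup>2 * dot n y (app n a y)"
    by (simp add: app_add app_scale dot_add_left dot_add_right dot_scale_left dot_scale_right
        algebra_simps power2_eq_square)
  then show "0 \<le> dot n x (app n a x) + 2 * t * dot n x (app n a y) + t\<^sup>2 * dot n y (app n a y)"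
    using assms(2) by metis
qed (rule assms(2))

text \<open>Pinning the coordinates from \<open>n\<close> on to zero places the set inside a product
  of compact intervals, compact by Tychonoff; the sphere equation is a closed condition.\<close>

lemma compact_coordinate_sphere:
  "compact {x :: nat \<Rightarrow> real. dot n x x = 1 \<and> (\<forall>i\<ge>n. x i = 0)}"
proof -
  define B where "B = (\<lambda>i. if i < n then {-1..1::real} else {0})"
  have "compactin (product_topology (\<lambda>i. euclidean) UNIV) (PiE UNIV B)"
    unfolding compactin_PiE by (auto simp: B_def compactin_euclidean_iff)
  then have "compact (PiE UNIV B)"
    by (simp add: euclidean_product_topology compactin_euclidean_iff)
  moreover have "closed {x. dot n x x = 1}"
    unfolding dot_def
    by (intro closed_Collect_eq continuous_intros continuous_on_product_coordinates)
  ultimately have "compact (PiE UNIV B \<inter> {x. dot n x x = 1})"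
    by (rule compact_Int_closed)
  also have "PiE UNIV B \<inter> {x. dot n x x = 1} = {x. dot n x x = 1 \<and> (\<forall>i\<ge>n. x i = 0)}"
  proof -
    have "\<bar>x i\<bar> \<le> 1" if "dot n x x = 1" "i < n" for x i
    proof -
      have "(x i)\<^sup>2 \<le> dot n x x"
        unfolding dot_self using that by (intro member_le_sum) auto
      then show ?thesis using that by (simp add: abs_square_le_1)
    qed
    then show ?thesis
      by (fastforce simp: B_def PiE_def Pi_def abs_le_iff split: if_splits)
  qed
  finally show ?thesis .
qed

text \<open>The minimiser of the Rayleigh quotient is an eigenvector: the form of \<open>a - \<mu>\<close> is nonnegative and
  vanishes at it, so by Cauchy-Schwarz for that form it lies in the kernel.\<close>

lemma Rayleigh_minimum:
  assumes "symm n a" "n \<ge> 1"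
  obtains \<mu> y where "dot n y y = 1" "\<And>i. i < n \<Longrightarrow> app n a y i = \<mu> * y i"
    "\<And>x. \<mu> * dot n x x \<le> dot n x (app n a x)"
proof -
  define S where "S = {x :: nat \<Rightarrow> real. dot n x x = 1 \<and> (\<forall>i\<ge>n. x i = 0)}"
  define Q where "Q = (\<lambda>x. dot n x (app n a x))"
  have "(\<lambda>i. if i = 0 then 1 else 0) \<in> S"
    using assms(2) by (auto simp: S_def dot_def sum.delta if_distrib cong: if_cong)
  then have "S \<noteq> {}" by blast
  moreover have "continuous_on S Q"
    unfolding Q_def dot_def app_def
    by (intro continuous_intros continuous_on_subset[OF continuous_on_product_coordinates]) auto
  ultimately obtain y where y: "y \<in> S" "\<And>x. x \<in> S \<Longrightarrow> Q y \<le> Q x"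
    using continuous_attains_inf[of S Q] compact_coordinate_sphere[of n] unfolding S_def by blast
  have min: "Q y * dot n x x \<le> dot n x (app n a x)" for x
  proof (cases "dot n x x = 0")
    case True
    then have "dot n x (app n a x) = 0"
      unfolding dot_self_eq_0_iff by (simp add: dot_def)
    then show ?thesis using True by simp
  next
    case False
    then have pos: "0 < dot n x x" by (metis dot_self_nonneg order_less_le)
    define r where "r = 1 / sqrt (dot n x x)"
    have r2: "r * r = 1 / dot n x x"
      using pos by (simp add: r_def)
    \<comment> \<open>Besides normalising, \<open>x'\<close> cuts off the coordinates from
      \<open>n\<close> on, as membership in \<open>S\<close> requires; \<open>dot\<close> and
      \<open>app\<close> do not see the cut.\<close>
    define x' where "x' = (\<lambda>i. r * (if i < n then x i else 0))"
    have x'x: "x' i = r * x i" if "i < n" for i using that by (simp add: x'_def)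
    have d: "dot n x' u = r * dot n x u" for u
      using x'x by (simp add: dot_def sum_distrib_left mult.assoc)
    have "app n a x' = (\<lambda>i. r * app n a x i)"
      using x'x by (auto simp: app_def sum_distrib_left algebra_simps)
    then have "Q x' = r * (r * dot n x (app n a x))"
      by (simp add: Q_def d dot_scale_right)
    moreover have "dot n x' x' = r * (r * dot n x x)"
      using d[of x'] d[of x] by (simp add: dot_commute)
    then have "x' \<in> S"
      using r2 pos by (simp add: S_def x'_def flip: mult.assoc)
    ultimately have "Q y \<le> dot n x (app n a x) / dot n x x"
      using y(2)[of x'] r2 by (simp flip: mult.assoc)
    then show ?thesis using pos by (simp add: field_simps)
  qed
  define b where "b = (\<lambda>i j. a i j - (if i = j then Q y else 0))"
  have appb: "app n b x i = app n a x i - Q y * x i" if "i < n" for x i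
  proof -
    have "b i j * x j = a i j * x j - (if j = i then Q y * x i else 0)" for j
      by (simp add: b_def left_diff_distrib)
    then show ?thesis using that by (simp add: app_def sum_subtractf)
  qed
  have Qb: "dot n x (app n b x') = dot n x (app n a x') - Q y * dot n x x'" for x x'
    by (simp add: dot_def appb algebra_simps sum_subtractf sum_distrib_left)
  have symb: "symm n b" using assms(1) by (auto simp: symm_def b_def)
  have yy: "dot n y y = 1" using y(1) by (simp add: S_def)
  have "(dot n (app n b y) (app n b y))\<^sup>2
      \<le> dot n (app n b y) (app n b (app n b y)) * dot n y (app n b y)"
    by (rule psd_Cauchy_Schwarz[OF symb]) (use min in \<open>simp add: Qb\<close>)
  also have "dot n y (app n b y) = 0"
    using yy by (simp add: Qb) (simp add: Q_def)
  finally have "dot n (app n b y) (app n b y) = 0" by simp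
  then have "app n a y i = Q y * y i" if "i < n" for i
    using that appb[OF that, of y] by (simp add: dot_self_eq_0_iff)
  then show thesis by (intro that[OF yy _ min])
qed

section \<open>Reality of the spectrum and the ordering of the eigenvalues\<close>

lemma symm_eigenvalue_real:
  fixes A :: "real mat" and e :: complex
  assumes A: "A \<in> carrier_mat n n" and sym: "transpose_mat A = A"
    and root: "poly (char_poly (map_mat complex_of_real A)) e = 0"
  shows "e \<in> \<real>"
proof -
  let ?A = "map_mat complex_of_real A"
  have A': "?A \<in> carrier_mat n n" using A by simp
  obtain v where v: "v \<in> carrier_vec n" "v \<noteq> 0\<^sub>v n" "?A *\<^sub>v v = e \<cdot>\<^sub>v v"
    using root A unfolding eigenvalue_root_char_poly[OF A', symmetric] eigenvalue_def eigenvector_def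
    by auto
  have ev: "(\<Sum>j<n. complex_of_real (A $$ (i, j)) * v $ j) = e * v $ i" if "i < n" for i
  proof -
    have "(?A *\<^sub>v v) $ i = (\<Sum>j<n. complex_of_real (A $$ (i, j)) * v $ j)"
      using that A v(1) by (simp add: scalar_prod_def lessThan_atLeast0)
    then show ?thesis using v that by simp
  qed
  define N where "N = (\<Sum>i<n. (cmod (v $ i))\<^sup>2)"
  have eN: "e * complex_of_real N = (\<Sum>i<n. \<Sum>j<n. cnj (v $ i) * complex_of_real (A $$ (i, j)) * v $ j)"
  proof -
    have "e * complex_of_real N = (\<Sum>i<n. cnj (v $ i) * (e * v $ i))"
      by (simp add: N_def sum_distrib_left complex_norm_square mult_ac flip: of_real_power)
    also have "\<dots> = (\<Sum>i<n. cnj (v $ i) * (\<Sum>j<n. complex_of_real (A $$ (i, j)) * v $ j))"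
      by (simp add: ev)
    finally show ?thesis by (simp add: sum_distrib_left mult.assoc)
  qed
  have Asym: "A $$ (i, j) = A $$ (j, i)" if "i < n" "j < n" for i j
    using arg_cong[OF sym, of "\<lambda>B. B $$ (i, j)"] A that by simp
  \<comment> \<open>\<open>e * complex_of_real N\<close> is the Hermitian form of \<open>A\<close>
    at \<open>v\<close>. Conjugation exchanges the two summation indices, and symmetry of the real
    matrix restores the original sum.\<close>
  have "cnj (e * complex_of_real N) = (\<Sum>i<n. \<Sum>j<n. v $ i * complex_of_real (A $$ (i, j)) * cnj (v $ j))"
    unfolding eN by simp
  also have "\<dots> = (\<Sum>j<n. \<Sum>i<n. v $ i * complex_of_real (A $$ (i, j)) * cnj (v $ j))"
    by (rule sum.swap)
  also have "\<dots> = e * complex_of_real N"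
    unfolding eN by (intro sum.cong refl) (simp add: Asym)
  finally have "cnj e * complex_of_real N = e * complex_of_real N" by simp
  moreover have "N \<noteq> 0"
  proof
    assume "N = 0"
    then have "v $ i = 0" if "i < n" for i
      using that by (simp add: N_def sum_nonneg_eq_0_iff)
    then have "v = 0\<^sub>v n" using v(1) by (intro eq_vecI) auto
    then show False using v(2) by simp
  qed
  ultimately show ?thesis by (simp add: Reals_cnj_iff)
qed

text \<open>Over the complex numbers there are \<open>n\<close> linear factors, all with real roots.
  The embedding of real polynomials is injective, so the factorisation descends.\<close>

lemma symm_char_poly_splits:
  fixes A :: "real mat"
  assumes A: "A \<in> carrier_mat n n" and sym: "transpose_mat A = A"
  obtains rs where "char_poly A = (\<Prod>r\<leftarrow>rs. [:- r, 1:])" "length rs = n"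
proof -
  let ?A = "map_mat complex_of_real A"
  interpret hp: map_poly_inj_comm_ring_hom complex_of_real ..
  have A': "?A \<in> carrier_mat n n" using A by simp
  from char_poly_factorized[OF A'] obtain as where
    as: "char_poly ?A = (\<Prod>a\<leftarrow>as. [:- a, 1:])" "length as = n" by blast
  have "a = complex_of_real (Re a)" if "a \<in> set as" for a
  proof -
    have "poly (char_poly ?A) a = 0"
      using that unfolding as by (auto simp: poly_prod_list prod_list_zero_iff)
    then show ?thesis using symm_eigenvalue_real[OF A sym] by (simp add: of_real_Re)
  qed
  then have "map_poly complex_of_real (char_poly A)
      = (\<Prod>a\<leftarrow>as. map_poly complex_of_real [:- Re a, 1:])"
    unfolding of_real_hom.char_poly_hom[OF A, symmetric] as
    by (intro arg_cong[where f = prod_list] map_cong refl) (simp add: map_poly_pCons)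
  also have "\<dots> = map_poly complex_of_real (\<Prod>r\<leftarrow>map Re as. [:- r, 1:])"
    by (simp add: hp.hom_prod_list comp_def)
  finally have "char_poly A = (\<Prod>r\<leftarrow>map Re as. [:- r, 1:])" by simp
  then show thesis using as(2) that[of "map Re as"] by simp
qed

text \<open>Since all \<open>n\<close> roots are real, the sorted list has length \<open>n\<close>
  and every admissible index hits an eigenvalue: after reversal \<open>eig 1\<close> reads its last
  entry and \<open>eig n\<close> its first.\<close>

lemma eig_bounds:
  fixes A :: "real mat"
  assumes A: "A \<in> carrier_mat n n" and sym: "transpose_mat A = A"
  shows eig_least: "eigenvalue A e \<Longrightarrow> eig n A \<le> e"
    and eig_greatest: "eigenvalue A e \<Longrightarrow> e \<le> eig 1 A"
    and eigenvalue_eig: "1 \<le> i \<Longrightarrow> i \<le> n \<Longrightarrow> eigenvalue A (eig i A)"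
proof -
  obtain rs where rs: "char_poly A = (\<Prod>r\<leftarrow>rs. [:- r, 1:])" "length rs = n"
    by (rule symm_char_poly_splits[OF A sym])
  have "proots (char_poly A) = mset rs"
  proof (unfold rs(1), induction rs)
    case (Cons r rs)
    have "(\<Prod>r\<leftarrow>rs. [:- r, 1:]) \<noteq> 0" by (auto simp: prod_list_zero_iff)
    then have "proots ([:- r, 1:] * (\<Prod>r\<leftarrow>rs. [:- r, 1:])) = {#r#} + proots (\<Prod>r\<leftarrow>rs. [:- r, 1:])"
      by (subst proots_mult) auto
    then show ?case using Cons by simp
  qed simp
  then have eig: "eig i A = rev (sort rs) ! (i - 1)" for i
    by (simp add: eig_def)
  have ev: "eigenvalue A e \<longleftrightarrow> e \<in> set rs" for e
    unfolding eigenvalue_root_char_poly[OF A] rs(1) by (induction rs) (auto simp del: set_sort)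
  show "eigenvalue A (eig i A)" if "1 \<le> i" "i \<le> n"
  proof -
    have "rev (sort rs) ! (i - 1) \<in> set (rev (sort rs))"
      using that rs(2) by (intro nth_mem) auto
    then show ?thesis unfolding ev eig by simp
  qed
  {
    assume "eigenvalue A e"
    then have "e \<in> set (sort rs)" unfolding ev by simp
    then obtain m where m: "m < n" "sort rs ! m = e"
      using rs(2) unfolding in_set_conv_nth by auto
    have "sort rs ! 0 \<le> sort rs ! m" "sort rs ! m \<le> sort rs ! (n - 1)"
      using m(1) rs(2) by (auto intro: sorted_nth_mono[OF sorted_sort])
    then show "eig n A \<le> e" "e \<le> eig 1 A"
      using m(1) unfolding eig m(2) by (simp_all add: rev_nth rs(2))
  }
qed

section \<open>Matrices acting on coordinate functions, and the Rayleigh bounds for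
  \<open>eig\<close>\<close>

definition mat_fun :: "real mat \<Rightarrow> nat \<Rightarrow> nat \<Rightarrow> real" where
  "mat_fun A = (\<lambda>i j. A $$ (i, j))"

lemma eigenvalue_mat_funI:
  assumes A: "A \<in> carrier_mat n n" and "dot n y y \<noteq> 0"
    and "\<And>i. i < n \<Longrightarrow> app n (mat_fun A) y i = e * y i"
  shows "eigenvalue A e"
proof -
  have "Matrix.vec n y \<noteq> 0\<^sub>v n"
  proof
    assume "Matrix.vec n y = 0\<^sub>v n"
    then have "Matrix.vec n y $ i = 0\<^sub>v n $ i" for i by simp
    then have "y i = 0" if "i < n" for i using that by (metis index_vec index_zero_vec(1))
    then show False using assms(2) by (simp add: dot_def)
  qed
  moreover have "A *\<^sub>v Matrix.vec n y = e \<cdot>\<^sub>v Matrix.vec n y"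
    using A assms(3) by (intro eq_vecI) (auto simp: scalar_prod_def app_def mat_fun_def lessThan_atLeast0)
  ultimately show ?thesis
    using A unfolding eigenvalue_def eigenvector_def by (intro exI[of _ "Matrix.vec n y"]) auto
qed

lemma eigenvalue_mat_funE:
  assumes A: "A \<in> carrier_mat n n" and "eigenvalue A e"
  obtains y where "dot n y y > 0" "\<forall>i<n. app n (mat_fun A) y i = e * y i"
proof -
  obtain v where v: "v \<in> carrier_vec n" "v \<noteq> 0\<^sub>v n" "A *\<^sub>v v = e \<cdot>\<^sub>v v"
    using assms unfolding eigenvalue_def eigenvector_def by auto
  have "app n (mat_fun A) (($) v) i = e * v $ i" if "i < n" for i
  proof -
    have "(A *\<^sub>v v) $ i = app n (mat_fun A) (($) v) i"
      using that A v(1) by (simp add: scalar_prod_def app_def mat_fun_def lessThan_atLeast0)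
    then show ?thesis using v that by simp
  qed
  moreover have "dot n (($) v) (($) v) \<noteq> 0"
    unfolding dot_self_eq_0_iff using v(1,2) by (auto simp: eq_vecI)
  ultimately show thesis by (intro that[of "($) v"]) (auto simp: order_less_le)
qed

lemma symm_mat_fun:
  assumes "A \<in> carrier_mat n n" "transpose_mat A = A"
  shows "symm n (mat_fun A)"
proof -
  have "A $$ (i, j) = A $$ (j, i)" if "i < n" "j < n" for i j
    using arg_cong[OF assms(2), of "\<lambda>B. B $$ (i, j)"] assms(1) that by simp
  then show ?thesis by (simp add: symm_def mat_fun_def)
qed

text \<open>The minimum of the Rayleigh quotient is attained at an eigenvector, hence is itself an
  eigenvalue and not below the least one.\<close>

lemma eig_least_le_form:
  assumes A: "A \<in> carrier_mat n n" and sym: "transpose_mat A = A" and "n \<ge> 1"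
  shows "eig n A * dot n x x \<le> dot n x (app n (mat_fun A) x)"
proof -
  obtain \<mu> y where y: "dot n y y = 1" "\<And>i. i < n \<Longrightarrow> app n (mat_fun A) y i = \<mu> * y i"
    "\<And>x. \<mu> * dot n x x \<le> dot n x (app n (mat_fun A) x)"
    by (rule Rayleigh_minimum[OF symm_mat_fun[OF A sym] \<open>n \<ge> 1\<close>]) blast
  have "eigenvalue A \<mu>" by (rule eigenvalue_mat_funI[OF A _ y(2)]) (use y(1) in auto)
  then have "eig n A * dot n x x \<le> \<mu> * dot n x x"
    by (intro mult_right_mono eig_least[OF A sym]) auto
  also note y(3)
  finally show ?thesis .
qed

text \<open>Rayleigh minimisation for the negated matrix: the sign change turns its minimum into an
  eigenvalue of \<open>A\<close>, at most the greatest one.\<close>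

lemma form_le_eig_greatest:
  assumes A: "A \<in> carrier_mat n n" and sym: "transpose_mat A = A" and "n \<ge> 1"
  shows "dot n x (app n (mat_fun A) x) \<le> eig 1 A * dot n x x"
proof -
  define a where "a = (\<lambda>i j. - mat_fun A i j)"
  have app_a: "app n a z i = - app n (mat_fun A) z i" for z i
    by (simp add: app_def a_def sum_negf)
  have "symm n a" using symm_mat_fun[OF A sym] by (simp add: symm_def a_def)
  from Rayleigh_minimum[OF this \<open>n \<ge> 1\<close>] obtain \<mu> y where y: "dot n y y = 1" "\<And>i. i < n \<Longrightarrow> app n a y i = \<mu> * y i"
    "\<And>x. \<mu> * dot n x x \<le> dot n x (app n a x)"
    by (metis (no_types, lifting))
  have "eigenvalue A (- \<mu>)"
  proof (rule eigenvalue_mat_funI[OF A, of y])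
    show "app n (mat_fun A) y i = - \<mu> * y i" if "i < n" for i
      using y(2)[OF that] app_a[of y i] by simp
  qed (simp add: y(1))
  have "dot n x (app n (mat_fun A) x) = - dot n x (app n a x)"
    by (simp add: dot_def app_a sum_negf)
  also have "\<dots> \<le> - \<mu> * dot n x x" using y(3)[of x] by simp
  also have "\<dots> \<le> eig 1 A * dot n x x"
    by (intro mult_right_mono eig_greatest[OF A sym] \<open>eigenvalue A (- \<mu>)\<close>) auto
  finally show ?thesis .
qed

section \<open>Second moments and orthonormal expansions\<close>

text \<open>Off the diagonal, independence factors the expectation into a product of zero means. The
  form \<open>has_bochner_integral\<close> carries integrability along with the value through finite
  sums.\<close>

lemma (in prob_space) pairwise_second_moment:
  fixes eps :: "nat \<Rightarrow> 'a \<Rightarrow> real"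
  assumes indep: "indep_vars (\<lambda>_. borel) eps {..<n}"
    and [measurable]: "\<And>j. j < n \<Longrightarrow> eps j \<in> borel_measurable M"
    and sq: "\<And>j. j < n \<Longrightarrow> integrable M (\<lambda>w. (eps j w)\<^sup>2)"
    and mean: "\<And>j. j < n \<Longrightarrow> expectation (eps j) = 0"
    and var: "\<And>j. j < n \<Longrightarrow> variance (eps j) = \<sigma>\<^sup>2"
    and ij: "i < n" "j < n"
  shows "has_bochner_integral M (\<lambda>w. eps i w * eps j w) (if i = j then \<sigma>\<^sup>2 else 0)"
proof (cases "i = j")
  case True
  then show ?thesis
    using sq[OF ij(2)] var[OF ij(2)] mean[OF ij(2)]
    by (simp add: has_bochner_integral_iff power2_eq_square)
next
  case False
  have int: "integrable M (eps k)" if "k < n" for k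
    by (rule square_integrable_imp_integrable[OF _ sq[OF that]]) (use that in measurable)
  have ind: "indep_vars (\<lambda>_. borel) eps {i, j}"
    using indep ij by (intro indep_vars_subset[OF indep]) auto
  have int': "integrable M (eps k)" if "k \<in> {i, j}" for k using that ij int by auto
  from indep_vars_lebesgue_integral[OF _ ind int'] indep_vars_integrable[OF _ ind int']
  have "(\<integral>w. eps i w * eps j w \<partial>M) = 0" "integrable M (\<lambda>w. eps i w * eps j w)"
    using False mean[OF ij(1)] by simp_all
  then show ?thesis using False by (simp add: has_bochner_integral_iff)
qed

text \<open>Expanding the square leaves only the diagonal of the double sum. A nonnegative integral
  is used so that the value can later be summed over all basis indices.\<close>

lemma (in prob_space) second_moment_linear_combination:
  fixes eps :: "nat \<Rightarrow> 'a \<Rightarrow> real"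
  assumes "indep_vars (\<lambda>_. borel) eps {..<n}"
    and "\<And>j. j < n \<Longrightarrow> eps j \<in> borel_measurable M"
    and "\<And>j. j < n \<Longrightarrow> integrable M (\<lambda>w. (eps j w)\<^sup>2)"
    and "\<And>j. j < n \<Longrightarrow> expectation (eps j) = 0"
    and "\<And>j. j < n \<Longrightarrow> variance (eps j) = \<sigma>\<^sup>2"
  shows "(\<integral>\<^sup>+ w. ennreal ((\<Sum>j<n. c j * eps j w)\<^sup>2) \<partial>M) = ennreal (\<sigma>\<^sup>2 * (\<Sum>j<n. (c j)\<^sup>2))"
proof -
  have "has_bochner_integral M (\<lambda>w. \<Sum>i<n. \<Sum>j<n. c i * c j * (eps i w * eps j w))
      (\<Sum>i<n. \<Sum>j<n. c i * c j * (if i = j then \<sigma>\<^sup>2 else 0))"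
    by (intro has_bochner_integral_sum has_bochner_integral_mult_right pairwise_second_moment[OF assms])
      auto
  moreover have "(\<Sum>i<n. \<Sum>j<n. c i * c j * (if i = j then \<sigma>\<^sup>2 else 0)) = \<sigma>\<^sup>2 * (\<Sum>j<n. (c j)\<^sup>2)"
    by (simp add: if_distrib sum.delta sum_distrib_left power2_eq_square mult_ac cong: if_cong)
  moreover have "(\<Sum>i<n. \<Sum>j<n. c i * c j * (eps i w * eps j w)) = (\<Sum>j<n. c j * eps j w)\<^sup>2" for w
    by (simp add: power2_eq_square sum_product mult_ac)
  ultimately have "has_bochner_integral M (\<lambda>w. (\<Sum>j<n. c j * eps j w)\<^sup>2) (\<sigma>\<^sup>2 * (\<Sum>j<n. (c j)\<^sup>2))"
    by simp
  then show ?thesis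
    by (subst nn_integral_eq_integral) (auto simp: has_bochner_integral_iff)
qed

section \<open>Square integrable functions and orthonormal series\<close>

lemma L2_mult_integrable:
  assumes "f \<in> L2 \<rho>" "g \<in> L2 \<rho>"
  shows "integrable \<rho> (\<lambda>x. f x * g x)"
proof (rule Bochner_Integration.integrable_bound)
  show "integrable \<rho> (\<lambda>x. (f x)\<^sup>2 + (g x)\<^sup>2)"
    using assms by (simp add: L2_def)
  show "(\<lambda>x. f x * g x) \<in> borel_measurable \<rho>"
    using assms by (auto simp add: L2_def)
  have "\<bar>u * v\<bar> \<le> u\<^sup>2 + v\<^sup>2" for u v :: real
  proof -
    have "2 * (\<bar>u\<bar> * \<bar>v\<bar>) \<le> u\<^sup>2 + v\<^sup>2"
      using sum_squares_bound[of "\<bar>u\<bar>" "\<bar>v\<bar>"] by simp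
    moreover have "0 \<le> \<bar>u\<bar> * \<bar>v\<bar>" by simp
    ultimately show ?thesis unfolding abs_mult by linarith
  qed
  then show "AE x in \<rho>. norm (f x * g x) \<le> norm ((f x)\<^sup>2 + (g x)\<^sup>2)" by simp
qed

lemma L2_add: "f \<in> L2 \<rho> \<Longrightarrow> g \<in> L2 \<rho> \<Longrightarrow> (\<lambda>x. f x + g x) \<in> L2 \<rho>"
  using L2_mult_integrable[of f \<rho> g] by (auto simp: L2_def power2_sum mult.assoc)

lemma L2_scale: "f \<in> L2 \<rho> \<Longrightarrow> (\<lambda>x. c * f x) \<in> L2 \<rho>"
  by (auto simp: L2_def power_mult_distrib)

lemma L2_diff: "f \<in> L2 \<rho> \<Longrightarrow> g \<in> L2 \<rho> \<Longrightarrow> (\<lambda>x. f x - g x) \<in> L2 \<rho>"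
  using L2_add[of f \<rho> "\<lambda>x. - 1 * g x"] L2_scale[of g \<rho> "- 1"] by simp

lemma L2_sum: "finite I \<Longrightarrow> (\<And>i. i \<in> I \<Longrightarrow> f i \<in> L2 \<rho>) \<Longrightarrow> (\<lambda>x. \<Sum>i\<in>I. f i x) \<in> L2 \<rho>"
  by (induction I rule: finite_induct) (auto intro: L2_add, simp add: L2_def)

context
  fixes \<rho> :: "'x measure" and \<psi> :: "nat \<Rightarrow> 'x \<Rightarrow> real"
  assumes \<psi>_L2: "\<And>i. i \<ge> 1 \<Longrightarrow> \<psi> i \<in> L2 \<rho>"
    and \<psi>_orth: "\<And>i j. i \<ge> 1 \<Longrightarrow> j \<ge> 1 \<Longrightarrow> L2_inner \<rho> (\<psi> i) (\<psi> j) = (if i = j then 1 else 0)"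
begin

lemma L2_combination: "finite I \<Longrightarrow> I \<subseteq> {1..} \<Longrightarrow> (\<lambda>x. \<Sum>i\<in>I. b i * \<psi> i x) \<in> L2 \<rho>"
  by (intro L2_sum L2_scale \<psi>_L2) auto

lemma L2_inner_combination:
  assumes "finite I" "I \<subseteq> {1..}" "j \<ge> 1"
  shows "L2_inner \<rho> (\<lambda>x. \<Sum>i\<in>I. b i * \<psi> i x) (\<psi> j) = (if j \<in> I then b j else 0)"
proof -
  have "L2_inner \<rho> (\<lambda>x. \<Sum>i\<in>I. b i * \<psi> i x) (\<psi> j) = (\<Sum>i\<in>I. b i * L2_inner \<rho> (\<psi> i) (\<psi> j))"
    unfolding L2_inner_def sum_distrib_right mult.assoc
    using assms by (subst Bochner_Integration.integral_sum) (auto intro!: L2_mult_integrable \<psi>_L2)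
  also have "\<dots> = (\<Sum>i\<in>I. if i = j then b j else 0)"
    using assms by (intro sum.cong refl) (auto simp: \<psi>_orth subset_iff)
  finally show ?thesis using assms by simp
qed

lemma integral_combination_square:
  assumes "finite I" "I \<subseteq> {1..}"
  shows "(\<integral>x. (\<Sum>i\<in>I. b i * \<psi> i x)\<^sup>2 \<partial>\<rho>) = (\<Sum>i\<in>I. (b i)\<^sup>2)"
proof -
  let ?S = "\<lambda>x. \<Sum>i\<in>I. b i * \<psi> i x"
  have "(\<integral>x. (?S x)\<^sup>2 \<partial>\<rho>) = (\<integral>x. (\<Sum>i\<in>I. b i * (?S x * \<psi> i x)) \<partial>\<rho>)"
    by (simp add: power2_eq_square sum_distrib_left mult_ac)
  also have "\<dots> = (\<Sum>i\<in>I. b i * L2_inner \<rho> ?S (\<psi> i))"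
    unfolding L2_inner_def using assms
    by (subst Bochner_Integration.integral_sum) (auto intro!: L2_mult_integrable L2_combination \<psi>_L2)
  also have "\<dots> = (\<Sum>i\<in>I. (b i)\<^sup>2)"
    using assms by (intro sum.cong refl) (auto simp: L2_inner_combination power2_eq_square subset_iff)
  finally show ?thesis .
qed

text \<open>Pairing the residual with \<open>\<psi> i\<close> gives the same number for every
  \<open>N \<ge> i\<close>. Its square is at most the squared norm of the residual, which tends to
  zero. This makes expansions unique.\<close>

lemma L2_sums_coefficient:
  assumes "L2_sums \<rho> (\<lambda>i x. b i * \<psi> i x) f" "i \<ge> 1"
  shows "b i = L2_inner \<rho> f (\<psi> i)"
proof -
  define S where "S = (\<lambda>N x. \<Sum>i=1..N. b i * \<psi> i x)"
  have S: "S N \<in> L2 \<rho>" for N unfolding S_def by (intro L2_combination) auto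
  have f: "f \<in> L2 \<rho>" and lim: "(\<lambda>N. \<integral>x. (f x - S N x)\<^sup>2 \<partial>\<rho>) \<longlonglongrightarrow> 0"
    using assms by (auto simp: L2_sums_def S_def)
  define t where "t = L2_inner \<rho> f (\<psi> i) - b i"
  have "t\<^sup>2 \<le> (\<integral>x. (f x - S N x)\<^sup>2 \<partial>\<rho>)" if "N \<ge> i" for N
  proof -
    define g where "g = (\<lambda>x. f x - S N x)"
    have g: "g \<in> L2 \<rho>" unfolding g_def by (intro L2_diff f S)
    have "L2_inner \<rho> g (\<psi> i) = L2_inner \<rho> f (\<psi> i) - L2_inner \<rho> (S N) (\<psi> i)"
      unfolding L2_inner_def g_def left_diff_distrib
      by (intro Bochner_Integration.integral_diff L2_mult_integrable f S \<psi>_L2 assms)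
    also have "L2_inner \<rho> (S N) (\<psi> i) = b i"
      unfolding S_def using that assms by (subst L2_inner_combination) auto
    finally have gi: "L2_inner \<rho> g (\<psi> i) = t" by (simp add: t_def)
    \<comment> \<open>Bessel for one vector: the squared distance of \<open>g\<close> from its
      projection onto \<open>\<psi> i\<close> is the squared norm of \<open>g\<close> minus
      \<open>t\<^sup>2\<close>.\<close>
    have "0 \<le> (\<integral>x. (g x - t * \<psi> i x)\<^sup>2 \<partial>\<rho>)" by simp
    also have "\<dots> = (\<integral>x. (g x)\<^sup>2 - 2 * t * (g x * \<psi> i x) + t\<^sup>2 * (\<psi> i x * \<psi> i x) \<partial>\<rho>)"
      by (simp add: power2_eq_square algebra_simps)
    also have "\<dots> = (\<integral>x. (g x)\<^sup>2 \<partial>\<rho>) - 2 * t * L2_inner \<rho> g (\<psi> i) + t\<^sup>2 * L2_inner \<rho> (\<psi> i) (\<psi> i)"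
    proof -
      have "integrable \<rho> (\<lambda>x. (g x)\<^sup>2)" using g by (simp add: L2_def)
      moreover have "integrable \<rho> (\<lambda>x. g x * \<psi> i x)" "integrable \<rho> (\<lambda>x. \<psi> i x * \<psi> i x)"
        using g assms by (auto intro!: L2_mult_integrable \<psi>_L2)
      ultimately show ?thesis unfolding L2_inner_def by simp
    qed
    also have "\<dots> = (\<integral>x. (g x)\<^sup>2 \<partial>\<rho>) - t\<^sup>2"
      using assms by (simp add: gi \<psi>_orth power2_eq_square)
    finally show ?thesis by (simp add: g_def)
  qed
  then have "t\<^sup>2 \<le> 0"
    by (intro tendsto_lowerbound[OF lim]) (auto simp: eventually_sequentially)
  then show ?thesis by (simp add: t_def)
qed

text \<open>Partial sums are Cauchy in \<open>L\<^sup>2\<close>, hence in \<open>L\<^sup>1\<close>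
  because the measure is a probability. A subsequence converges almost everywhere, and Fatou's lemma
  carries the \<open>L\<^sup>2\<close> tail bounds over to its limit.\<close>

lemma Riesz_Fischer:
  assumes "prob_space \<rho>" and b: "summable (\<lambda>i. (b (Suc i))\<^sup>2)"
  shows "\<exists>f. L2_sums \<rho> (\<lambda>i x. b i * \<psi> i x) f"
proof -
  interpret prob_space \<rho> by fact
  define S where "S = (\<lambda>N x. \<Sum>i=1..N. b i * \<psi> i x)"
  have S: "S N \<in> L2 \<rho>" for N unfolding S_def by (intro L2_combination) auto
  have S_meas [measurable]: "S N \<in> borel_measurable \<rho>" for N using S by (simp add: L2_def)
  \<comment> \<open>\<open>T N\<close> is the tail of the coefficient series after \<open>N\<close>
    terms, which bounds every squared distance from \<open>S N\<close> to a later partial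
    sum.\<close>
  define T where "T = (\<lambda>N. (\<Sum>i. (b (Suc i))\<^sup>2) - (\<Sum>i<N. (b (Suc i))\<^sup>2))"
  have T0: "T \<longlonglongrightarrow> 0"
    unfolding T_def using tendsto_diff[OF tendsto_const[of "\<Sum>i. (b (Suc i))\<^sup>2"] summable_LIMSEQ[OF b]] by simp
  have dist: "(\<integral>x. (S N' x - S N x)\<^sup>2 \<partial>\<rho>) \<le> T N" if "N \<le> N'" for N N'
  proof -
    have "S N' x - S N x = (\<Sum>i\<in>{N<..N'}. b i * \<psi> i x)" for x
    proof -
      have "{1..N'} = {1..N} \<union> {N<..N'}" using that by auto
      then have "S N' x = S N x + (\<Sum>i\<in>{N<..N'}. b i * \<psi> i x)"
        unfolding S_def by (simp add: sum.union_disjoint ivl_disj_int)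
      then show ?thesis by simp
    qed
    then have "(\<integral>x. (S N' x - S N x)\<^sup>2 \<partial>\<rho>) = (\<Sum>i\<in>{N<..N'}. (b i)\<^sup>2)"
      using integral_combination_square[of "{N<..N'}" b] by (simp add: subset_iff)
    also have "\<dots> = (\<Sum>i\<in>{N..<N'}. (b (Suc i))\<^sup>2)"
      by (rule sum.reindex_bij_witness[of _ Suc "\<lambda>i. i - 1"]) auto
    also have "\<dots> = (\<Sum>i<N'. (b (Suc i))\<^sup>2) - (\<Sum>i<N. (b (Suc i))\<^sup>2)"
      using that by (simp add: sum_diff_nat_ivl lessThan_atLeast0)
    also have "\<dots> \<le> T N"
      unfolding T_def using sum_le_suminf[OF b, of "{..<N'}"] by simp
    finally show ?thesis .
  qed
  \<comment> \<open>The variance of \<open>norm (S i x - S j x)\<close> is nonnegative, which is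
    Jensen's inequality on a space of mass one.\<close>
  have L1: "(\<integral>x. norm (S i x - S j x) \<partial>\<rho>)\<^sup>2 \<le> (\<integral>x. (S i x - S j x)\<^sup>2 \<partial>\<rho>)" for i j
  proof -
    have sq: "integrable \<rho> (\<lambda>x. (S i x - S j x)\<^sup>2)"
      using L2_diff[OF S S] by (simp add: L2_def)
    have "integrable \<rho> (\<lambda>x. S i x - S j x)"
      by (rule square_integrable_imp_integrable[OF _ sq]) measurable
    then have "integrable \<rho> (\<lambda>x. norm (S i x - S j x))" by simp
    from variance_eq[OF this] variance_positive[of "\<lambda>x. norm (S i x - S j x)"] sq
    show ?thesis by simp
  qed
  have S_int: "integrable \<rho> (S N)" for N
    using S[of N] by (auto simp: L2_def intro: square_integrable_imp_integrable[OF S_meas])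
  have Cauchy: "\<exists>N. \<forall>i\<ge>N. \<forall>j\<ge>N. (\<integral>x. norm (S i x - S j x) \<partial>\<rho>) < e" if "e > 0" for e
  proof -
    from order_tendstoD(2)[OF T0, of "e\<^sup>2"] that obtain N where N: "\<And>i. i \<ge> N \<Longrightarrow> T i < e\<^sup>2"
      by (auto simp: eventually_sequentially)
    have "(\<integral>x. norm (S i x - S j x) \<partial>\<rho>) < e" if "i \<ge> N" "j \<ge> N" for i j
    proof -
      have "(\<integral>x. (S i x - S j x)\<^sup>2 \<partial>\<rho>) < e\<^sup>2"
        using dist[of i j] dist[of j i] N[OF that(1)] N[OF that(2)]
        by (cases "i \<le> j") (auto simp: power2_commute[of "S i _"])
      with L1[of i j] have "(\<integral>x. norm (S i x - S j x) \<partial>\<rho>)\<^sup>2 < e\<^sup>2" by linarith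
      then show ?thesis using \<open>e > 0\<close> by (simp add: power2_less_imp_less)
    qed
    then show ?thesis by blast
  qed
  obtain r where r: "strict_mono r" "AE x in \<rho>. Cauchy (\<lambda>i. S (r i) x)"
    by (rule cauchy_L1_AE_cauchy_subseq[of \<rho> S, OF S_int Cauchy])
  \<comment> \<open>Off the null set of divergence this is the pointwise limit; on it,
    \<open>lim\<close> returns an unspecified value that no integral sees.\<close>
  define f where "f = (\<lambda>x. lim (\<lambda>i. S (r i) x))"
  have [measurable]: "f \<in> borel_measurable \<rho>" unfolding f_def by measurable
  have conv: "AE x in \<rho>. (\<lambda>i. S (r i) x) \<longlonglongrightarrow> f x"
    using r(2) unfolding f_def by eventually_elim (metis Cauchy_convergent convergent_LIMSEQ_iff)
  have bound: "(\<integral>\<^sup>+ x. ennreal ((f x - S N x)\<^sup>2) \<partial>\<rho>) \<le> ennreal (T N)" for N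
  proof -
    have "(\<integral>\<^sup>+ x. ennreal ((f x - S N x)\<^sup>2) \<partial>\<rho>)
        = (\<integral>\<^sup>+ x. liminf (\<lambda>m. ennreal ((S (r m) x - S N x)\<^sup>2)) \<partial>\<rho>)"
    proof (rule nn_integral_cong_AE)
      show "AE x in \<rho>. ennreal ((f x - S N x)\<^sup>2) = liminf (\<lambda>m. ennreal ((S (r m) x - S N x)\<^sup>2))"
        using conv
      proof eventually_elim
        case (elim x)
        then have "(\<lambda>m. ennreal ((S (r m) x - S N x)\<^sup>2)) \<longlonglongrightarrow> ennreal ((f x - S N x)\<^sup>2)"
          by (intro tendsto_intros tendsto_ennrealI)
        then show ?case by (intro lim_imp_Liminf[symmetric]) auto
      qed
    qed
    also have "\<dots> \<le> liminf (\<lambda>m. \<integral>\<^sup>+ x. ennreal ((S (r m) x - S N x)\<^sup>2) \<partial>\<rho>)"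
      by (rule nn_integral_liminf) measurable
    also have "\<dots> \<le> liminf (\<lambda>m::nat. ennreal (T N))"
    proof (rule Liminf_mono)
      have "(\<integral>\<^sup>+ x. ennreal ((S (r m) x - S N x)\<^sup>2) \<partial>\<rho>) \<le> ennreal (T N)" if "m \<ge> N" for m
      proof -
        have "integrable \<rho> (\<lambda>x. (S (r m) x - S N x)\<^sup>2)"
          using L2_diff[OF S S] by (simp add: L2_def)
        moreover have "N \<le> r m" using that seq_suble[OF r(1), of m] by linarith
        ultimately show ?thesis
          using dist[of N "r m"] by (subst nn_integral_eq_integral) (auto intro: ennreal_leI)
      qed
      then show "\<forall>\<^sub>F m in sequentially. (\<integral>\<^sup>+ x. ennreal ((S (r m) x - S N x)\<^sup>2) \<partial>\<rho>) \<le> ennreal (T N)"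
        by (auto simp: eventually_sequentially)
    qed
    also have "\<dots> = ennreal (T N)" by (simp add: Liminf_const)
    finally show ?thesis .
  qed
  have int: "integrable \<rho> (\<lambda>x. (f x - S N x)\<^sup>2)" for N
    using le_less_trans[OF bound[of N] ennreal_less_top] by (intro integrableI_bounded) auto
  have T_nonneg: "0 \<le> T N" for N
    unfolding T_def using sum_le_suminf[OF b, of "{..<N}"] by simp
  have "(\<integral>x. (f x - S N x)\<^sup>2 \<partial>\<rho>) \<le> T N" for N
    using bound[of N] T_nonneg by (subst (asm) nn_integral_eq_integral[OF int]) auto
  then have "(\<lambda>N. \<integral>x. (f x - S N x)\<^sup>2 \<partial>\<rho>) \<longlonglongrightarrow> 0"
    by (intro tendsto_sandwich[OF _ _ tendsto_const T0]) auto
  \<comment> \<open>\<open>S 0\<close> is the empty sum, so the residual at \<open>N = 0\<close> is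
    \<open>f\<close> itself.\<close>
  moreover have "f \<in> L2 \<rho>"
    using int[of 0] by (simp add: L2_def S_def)
  ultimately have "L2_sums \<rho> (\<lambda>i x. b i * \<psi> i x) f"
    unfolding L2_sums_def S_def by (auto intro!: L2_scale \<psi>_L2)
  then show ?thesis by blast
qed

text \<open>Both choice operators are resolved here. Riesz-Fischer supplies a sum for
  \<open>L2_suminf\<close>; as every \<open>lam i\<close> is positive, the coefficients are
  determined and the description in \<open>Hs_norm\<close> has one value. The bound \<open>C\<close>
  keeps the weighted coefficients square summable.\<close>

lemma Hs_norm_L2_suminf:
  assumes "prob_space \<rho>" and "\<And>i. i \<ge> 1 \<Longrightarrow> lam i > 0" and "\<And>i. i \<ge> 1 \<Longrightarrow> lam i \<le> C" and "s \<ge> 0"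
    and a: "summable (\<lambda>i. (a (Suc i))\<^sup>2)"
  shows "(Hs_norm \<rho> lam \<psi> s (L2_suminf \<rho> (\<lambda>i x. a i * lam i powr (s / 2) * \<psi> i x)))\<^sup>2
      = (\<Sum>i. ennreal ((a (Suc i))\<^sup>2))"
proof -
  define b where "b = (\<lambda>i. a i * lam i powr (s / 2))"
  have "(b (Suc i))\<^sup>2 \<le> (C powr s) * (a (Suc i))\<^sup>2" for i
  proof -
    have "(lam (Suc i) powr (s / 2))\<^sup>2 = lam (Suc i) powr s"
      by (simp add: power2_eq_square flip: powr_add)
    also have "\<dots> \<le> C powr s"
      using assms(2)[of "Suc i"] assms(3)[of "Suc i"] \<open>s \<ge> 0\<close> by (intro powr_mono2) auto
    finally show ?thesis
      unfolding b_def power_mult_distrib by (subst mult.commute) (intro mult_right_mono, auto)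
  qed
  then have "summable (\<lambda>i. (b (Suc i))\<^sup>2)"
    by (intro summable_comparison_test'[OF summable_mult[OF a]]) auto
  from Riesz_Fischer[OF assms(1) this]
  have "\<exists>f. L2_sums \<rho> (\<lambda>i x. a i * lam i powr (s / 2) * \<psi> i x) f"
    by (simp add: b_def)
  then have sums: "L2_sums \<rho> (\<lambda>i x. a i * lam i powr (s / 2) * \<psi> i x)
      (L2_suminf \<rho> (\<lambda>i x. a i * lam i powr (s / 2) * \<psi> i x))" (is "L2_sums \<rho> _ ?f")
    unfolding L2_suminf_def by (rule someI_ex)
  have coeffs: "Hs_coeffs \<rho> lam \<psi> s ?f a"
    unfolding Hs_coeffs_def using a sums by blast
  \<comment> \<open>Dividing by the nonzero weight identifies the coefficients from index
    \<open>1\<close> on; the value at \<open>0\<close> is unconstrained, hence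
    \<open>Suc\<close>.\<close>
  have "a' (Suc i) = a (Suc i)" if "Hs_coeffs \<rho> lam \<psi> s ?f a'" for a' i
  proof -
    have "a' (Suc i) * lam (Suc i) powr (s / 2) = L2_inner \<rho> ?f (\<psi> (Suc i))"
      using that unfolding Hs_coeffs_def by (intro L2_sums_coefficient) auto
    also have "\<dots> = a (Suc i) * lam (Suc i) powr (s / 2)"
      by (rule L2_sums_coefficient[OF sums, symmetric]) simp
    finally show ?thesis using assms(2)[of "Suc i"] by simp
  qed
  note uniq = this
  have "(THE r. \<exists>a'. Hs_coeffs \<rho> lam \<psi> s ?f a' \<and> r = sqrt (\<Sum>i. (a' (Suc i))\<^sup>2))
      = sqrt (\<Sum>i. (a (Suc i))\<^sup>2)"
  proof (rule the_equality)
    fix r assume "\<exists>a'. Hs_coeffs \<rho> lam \<psi> s ?f a' \<and> r = sqrt (\<Sum>i. (a' (Suc i))\<^sup>2)"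
    then obtain a' where a': "Hs_coeffs \<rho> lam \<psi> s ?f a'" "r = sqrt (\<Sum>i. (a' (Suc i))\<^sup>2)" by blast
    show "r = sqrt (\<Sum>i. (a (Suc i))\<^sup>2)" unfolding a'(2) uniq[OF a'(1)] ..
  qed (use coeffs in blast)
  moreover have "?f \<in> Hs \<rho> lam \<psi> s" unfolding Hs_def using coeffs by blast
  ultimately have "(Hs_norm \<rho> lam \<psi> s ?f)\<^sup>2 = (ennreal (sqrt (\<Sum>i. (a (Suc i))\<^sup>2)))\<^sup>2"
    unfolding Hs_norm_def by simp
  also have "\<dots> = ennreal (\<Sum>i. (a (Suc i))\<^sup>2)"
    using suminf_nonneg[OF a] by (simp add: ennreal_power)
  finally show ?thesis using a by (simp add: suminf_ennreal2)
qed

end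

section \<open>Linear systems with a positive definite matrix\<close>

text \<open>Coercivity and Cauchy-Schwarz give
  \<open>m |w|\<^sup>2 \<le> w \<cdot> q \<le> |w| |q|\<close>; the squared version avoids
  roots.\<close>

lemma norm_solution_le:
  assumes "m > 0" and lower: "m * dot n w w \<le> dot n w (app n a w)"
    and sol: "\<And>j. j < n \<Longrightarrow> app n a w j = q j"
  shows "dot n w w \<le> dot n q q / m\<^sup>2"
proof (cases "dot n w w = 0")
  case True
  then show ?thesis by simp
next
  case False
  then have pos: "0 < dot n w w" by (metis dot_self_nonneg order_less_le)
  have "dot n w (app n a w) = dot n w q" by (rule dot_cong) (simp_all add: sol)
  then have "(m * dot n w w)\<^sup>2 \<le> (dot n w q)\<^sup>2"
    using lower assms(1) by (intro power_mono) auto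
  also note dot_Cauchy_Schwarz
  finally have "dot n w w * (m\<^sup>2 * dot n w w) \<le> dot n w w * dot n q q"
    by (simp add: power2_eq_square mult_ac)
  then have "m\<^sup>2 * dot n w w \<le> dot n q q" using pos by simp
  then show ?thesis using assms(1) by (simp add: field_simps)
qed

text \<open>The operator inequality \<open>a\<^sup>2 \<le> L a\<close> for
  \<open>0 \<le> a \<le> L\<close>, without a square root of \<open>a\<close>: Cauchy-Schwarz for
  the form of \<open>a\<close>, applied to \<open>w\<close> and \<open>a w\<close>, leaves one
  factor \<open>|a w|\<^sup>2\<close> to cancel.\<close>

lemma norm_app_le:
  assumes sym: "symm n a" and psd: "\<And>v. 0 \<le> dot n v (app n a v)"
    and upper: "\<And>v. dot n v (app n a v) \<le> L * dot n v v"
  shows "dot n (app n a w) (app n a w) \<le> L * dot n w (app n a w)"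
proof -
  define y where "y = app n a w"
  show ?thesis
  proof (cases "dot n y y = 0")
    case True
    have "(dot n w y)\<^sup>2 \<le> 0" using dot_Cauchy_Schwarz[of n w y] True by simp
    then have "dot n w y = 0" by simp
    then show ?thesis using True by (simp add: y_def)
  next
    case False
    then have pos: "0 < dot n y y" by (metis dot_self_nonneg order_less_le)
    have "dot n w (app n a y) = dot n y y"
      using dot_app_symm[OF sym, of w y] by (simp add: y_def)
    then have "(dot n y y)\<^sup>2 \<le> dot n w (app n a w) * dot n y (app n a y)"
      using psd_Cauchy_Schwarz[OF sym psd, of w y] by simp
    also have "\<dots> \<le> dot n w (app n a w) * (L * dot n y y)"
      by (intro mult_left_mono upper psd)
    finally have "dot n y y * dot n y y \<le> dot n y y * (L * dot n w (app n a w))"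
      by (simp add: power2_eq_square mult_ac)
    then show ?thesis using pos by (simp add: y_def)
  qed
qed

text \<open>Writing \<open>a w = \<Sum>\<^sub>l u\<^sub>l q\<^sub>l\<close> with \<open>u = e\<^sub>i - d \<cdot> (q\<^sup>T w)\<close>, the energy \<open>t = w\<^sup>T a w\<close> equals
  \<open>u\<^sub>i / d\<^sub>i - \<Sum>\<^sub>l u\<^sub>l\<^sup>2 / d\<^sub>l\<close>, so \<open>t\<^sup>2 \<le> \<bar>u\<bar>\<^sup>2 / d\<^sub>i\<^sup>2\<close>, while \<open>\<mu> \<bar>u\<bar>\<^sup>2 \<le> \<bar>a w\<bar>\<^sup>2 \<le> L t\<close>.\<close>

lemma norm_perturbed_solution_le:
  assumes sym: "symm n a" and "0 < m" "0 \<le> L" "0 < \<mu>"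
    and lower: "\<And>v. m * dot n v v \<le> dot n v (app n a v)"
    and upper: "\<And>v. dot n v (app n a v) \<le> L * dot n v v"
    and "finite I" "i \<in> I" and d: "\<And>l. l \<in> I \<Longrightarrow> 0 < d l"
    and gram: "\<And>u. \<mu> * (\<Sum>l\<in>I. (u l)\<^sup>2) \<le> (\<Sum>j<n. (\<Sum>l\<in>I. u l * q l j)\<^sup>2)"
    and sol: "\<And>j. j < n \<Longrightarrow> app n a w j + (\<Sum>l\<in>I. d l * dot n (q l) w * q l j) = q i j"
  shows "dot n w w \<le> L / (m * \<mu> * (d i)\<^sup>2)"
proof -
  have psd: "0 \<le> dot n v (app n a v)" for v
    using lower[of v] \<open>0 < m\<close> by (meson dot_self_nonneg less_imp_le mult_nonneg_nonneg order_trans)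
  define b where "b = (\<lambda>l. dot n (q l) w)"
  define u where "u = (\<lambda>l. (if l = i then 1 else 0) - d l * b l)"
  define t where "t = dot n w (app n a w)"
  have t0: "0 \<le> t" using psd by (simp add: t_def)
  have aw: "app n a w j = (\<Sum>l\<in>I. u l * q l j)" if "j < n" for j
  proof -
    have "(\<Sum>l\<in>I. u l * q l j) = (\<Sum>l\<in>I. (if l = i then q l j else 0)) - (\<Sum>l\<in>I. d l * b l * q l j)"
      unfolding sum_subtractf[symmetric] u_def by (intro sum.cong refl) (simp add: left_diff_distrib)
    also have "(\<Sum>l\<in>I. (if l = i then q l j else 0)) = q i j"
      using \<open>finite I\<close> \<open>i \<in> I\<close> by simp
    finally show ?thesis using sol[OF that] by (simp add: b_def)
  qed
  have "t = (\<Sum>j<n. w j * (\<Sum>l\<in>I. u l * q l j))"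
    unfolding t_def dot_def by (intro sum.cong refl) (simp add: aw)
  also have "\<dots> = (\<Sum>l\<in>I. \<Sum>j<n. u l * (q l j * w j))"
    unfolding sum_distrib_left by (subst sum.swap) (simp add: mult_ac)
  also have "\<dots> = (\<Sum>l\<in>I. u l * b l)"
    by (simp add: b_def dot_def sum_distrib_left)
  \<comment> \<open>Solving the definition of \<open>u l\<close> for \<open>b l\<close> produces the
    terms \<open>- (u l)\<^sup>2 / d l\<close>, which are discarded.\<close>
  also have "\<dots> \<le> (\<Sum>l\<in>I. if l = i then u l / d l else 0)"
  proof (rule sum_mono)
    fix l assume "l \<in> I"
    then have dl: "0 < d l" by (rule d)
    show "u l * b l \<le> (if l = i then u l / d l else 0)"
    proof (cases "l = i")
      case True
      then have "b l = (1 - u l) / d l" using dl by (simp add: u_def field_simps)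
      then have "u l * b l = u l / d l - (u l)\<^sup>2 / d l"
        by (simp add: power2_eq_square diff_divide_distrib right_diff_distrib)
      then show ?thesis using True dl by simp
    next
      case False
      then have "b l = - u l / d l" using dl by (simp add: u_def)
      then have "u l * b l = - ((u l)\<^sup>2 / d l)" by (simp add: power2_eq_square)
      then show ?thesis using False dl by simp
    qed
  qed
  also have "\<dots> = u i / d i" using \<open>finite I\<close> \<open>i \<in> I\<close> by simp
  finally have "t\<^sup>2 \<le> (u i)\<^sup>2 / (d i)\<^sup>2"
    using t0 by (metis power_divide power_mono)
  also have "\<dots> \<le> (L * t / \<mu>) / (d i)\<^sup>2"
  proof (rule divide_right_mono)
    have "(u i)\<^sup>2 \<le> (\<Sum>l\<in>I. (u l)\<^sup>2)"
      using \<open>finite I\<close> \<open>i \<in> I\<close> by (intro member_le_sum) auto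
    then have "\<mu> * (u i)\<^sup>2 \<le> \<mu> * (\<Sum>l\<in>I. (u l)\<^sup>2)" using \<open>0 < \<mu>\<close> by simp
    also have "\<dots> \<le> (\<Sum>j<n. (\<Sum>l\<in>I. u l * q l j)\<^sup>2)" by (rule gram)
    also have "\<dots> = dot n (app n a w) (app n a w)"
      unfolding dot_self by (intro sum.cong refl) (simp add: aw)
    also have "\<dots> \<le> L * t" unfolding t_def by (rule norm_app_le[OF sym psd upper])
    finally show "(u i)\<^sup>2 \<le> L * t / \<mu>" using \<open>0 < \<mu>\<close> by (simp add: field_simps)
  qed simp
  \<comment> \<open>The square of the energy is bounded linearly in the energy, so one factor
    \<open>t\<close> cancels unless it is zero.\<close>
  finally have tt: "t * t \<le> L / (\<mu> * (d i)\<^sup>2) * t" by (simp add: power2_eq_square)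
  have "t \<le> L / (\<mu> * (d i)\<^sup>2)"
  proof (cases "t = 0")
    case True
    then show ?thesis using \<open>0 \<le> L\<close> \<open>0 < \<mu>\<close> by simp
  next
    case False
    then have "0 < t" using t0 by simp
    then show ?thesis using mult_right_le_imp_le[OF tt] by simp
  qed
  then have "m * dot n w w \<le> L / (\<mu> * (d i)\<^sup>2)" using lower[of w] by (simp add: t_def)
  then have "dot n w w \<le> L / (\<mu> * (d i)\<^sup>2) / m"
    using \<open>0 < m\<close> by (subst pos_le_divide_eq) (simp_all only: mult.commute)
  then show ?thesis by (simp add: mult_ac)
qed

section \<open>The variance of the estimator\<close>

lemma K_tail_carrier: "K_tail p lam \<psi> \<beta> n k x \<in> carrier_mat n n"
  by (simp add: K_tail_def)

lemma K_tail_reg_carrier: "K_tail_reg p lam \<psi> \<beta> \<gamma> n k x \<in> carrier_mat n n"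
  by (simp add: K_tail_reg_def K_tail_def)

lemma K_tail_symm: "transpose_mat (K_tail p lam \<psi> \<beta> n k x) = K_tail p lam \<psi> \<beta> n k x"
  by (rule eq_matI) (auto simp: K_tail_def Let_def mult_ac)

lemma K_tail_reg_symm: "transpose_mat (K_tail_reg p lam \<psi> \<beta> \<gamma> n k x) = K_tail_reg p lam \<psi> \<beta> \<gamma> n k x"
  by (rule eq_matI) (auto simp: K_tail_reg_def K_tail_def Let_def mult_ac)

lemma app_add_scaled_identity:
  assumes "A \<in> carrier_mat n n" "i < n"
  shows "app n (mat_fun (A + c \<cdot>\<^sub>m 1\<^sub>m n)) v i = app n (mat_fun A) v i + c * v i"
proof -
  have "app n (mat_fun (A + c \<cdot>\<^sub>m 1\<^sub>m n)) v i = (\<Sum>j<n. A $$ (i, j) * v j + (if j = i then c * v i else 0))"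
    unfolding app_def mat_fun_def using assms by (intro sum.cong refl) (auto simp: algebra_simps)
  then show ?thesis
    using assms(2) by (simp add: sum.distrib app_def mat_fun_def)
qed

lemma app_smult_mat:
  assumes "A \<in> carrier_mat n n" "i < n"
  shows "app n (mat_fun (c \<cdot>\<^sub>m A)) v i = c * app n (mat_fun A) v i"
  unfolding app_def mat_fun_def sum_distrib_left
  using assms by (intro sum.cong refl) auto

text \<open>The finite head of each convergent entry series is split off: the full matrix is the
  tail plus a perturbation of rank at most \<open>k\<close>, written in the form in which it acts on
  a vector.\<close>

lemma app_K_tail_split:
  assumes summ: "\<And>j l. j < n \<Longrightarrow> l < n \<Longrightarrow> summable (\<lambda>m. (p (Suc m))\<^sup>2 * lam (Suc m) powr \<beta>
          * \<psi> (Suc m) (x j) * \<psi> (Suc m) (x l))" and "j < n"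
  shows "app n (mat_fun (K_tail_reg p lam \<psi> \<beta> \<gamma> n 0 x)) v j
    = app n (mat_fun (K_tail_reg p lam \<psi> \<beta> \<gamma> n k x)) v j
      + (\<Sum>i=1..k. (p i)\<^sup>2 * lam i powr \<beta> * dot n (\<lambda>l. \<psi> i (x l)) v * \<psi> i (x j))"
proof -
  define f where "f = (\<lambda>i j l. (p i)\<^sup>2 * lam i powr \<beta> * \<psi> i (x j) * \<psi> i (x l))"
  have "(\<Sum>m. f (0 + Suc m) j l) = (\<Sum>m. f (k + Suc m) j l) + (\<Sum>i=1..k. f i j l)" if "l < n" for l
  proof -
    have "summable (\<lambda>m. f (Suc m) j l)"
      using summ[OF \<open>j < n\<close> that] by (simp add: f_def)
    from suminf_split_initial_segment[OF this, of k] show ?thesis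
      by (simp add: add.commute sum.atLeast1_atMost_eq)
  qed
  then have entry: "K_tail p lam \<psi> \<beta> n 0 x $$ (j, l)
      = K_tail p lam \<psi> \<beta> n k x $$ (j, l) + (\<Sum>i=1..k. f i j l)" if "l < n" for l
    using that \<open>j < n\<close> by (simp add: K_tail_def Let_def f_def)
  have "app n (mat_fun (K_tail p lam \<psi> \<beta> n 0 x)) v j
      = app n (mat_fun (K_tail p lam \<psi> \<beta> n k x)) v j + (\<Sum>l<n. (\<Sum>i=1..k. f i j l) * v l)"
    unfolding app_def mat_fun_def by (simp add: entry distrib_right sum.distrib)
  also have "(\<Sum>l<n. (\<Sum>i=1..k. f i j l) * v l)
      = (\<Sum>i=1..k. (p i)\<^sup>2 * lam i powr \<beta> * dot n (\<lambda>l. \<psi> i (x l)) v * \<psi> i (x j))"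
    unfolding sum_distrib_right dot_def sum_distrib_left f_def
    by (subst sum.swap) (simp add: mult_ac)
  finally show ?thesis
    unfolding K_tail_reg_def using \<open>j < n\<close> by (simp add: app_add_scaled_identity[OF K_tail_carrier])
qed

text \<open>Coercivity rules out the eigenvalue zero, hence the determinant is nonzero. An actual
  value of \<open>mat_inverse\<close> matters because \<open>fhat\<close> applies \<open>the\<close>
  to it.\<close>

lemma mat_inverse_exists:
  fixes A :: "real mat"
  assumes A: "A \<in> carrier_mat n n" and m: "m > 0"
    and pd: "\<And>v. m * dot n v v \<le> dot n v (app n (mat_fun A) v)"
  obtains W where "mat_inverse A = Some W" "A * W = 1\<^sub>m n" "W * A = 1\<^sub>m n" "W \<in> carrier_mat n n"
proof -
  have "\<not> eigenvalue A 0"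
  proof
    assume "eigenvalue A 0"
    then obtain y where y: "dot n y y > 0" "\<forall>i<n. app n (mat_fun A) y i = 0 * y i"
      by (rule eigenvalue_mat_funE[OF A])
    have "dot n y (app n (mat_fun A) y) = dot n y (\<lambda>i. 0)"
      by (rule dot_cong) (simp_all add: y(2))
    with pd[of y] have "m * dot n y y \<le> 0" by (simp add: dot_def)
    moreover have "0 < m * dot n y y" using m y(1) by simp
    ultimately show False by linarith
  qed
  moreover have "char_matrix A 0 = A"
    using A by (intro eq_matI) (auto simp: char_matrix_def)
  ultimately have "det A \<noteq> 0"
    unfolding eigenvalue_det[OF A] by simp
  then have "A \<in> Units (ring_mat TYPE(real) n ())" by (rule det_non_zero_imp_unit[OF A])
  then have "mat_inverse A \<noteq> None" using mat_inverse(1)[OF A, where b = "()"] by blast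
  then obtain W where "mat_inverse A = Some W" by blast
  with mat_inverse(2)[OF A this] show thesis by (intro that) auto
qed

text \<open>The squared norm is a series of squares of linear forms in the noise. Nonnegative terms
  let expectation and series be exchanged, and each term is then a second moment.\<close>

lemma variance_term_eq:
  assumes M: "prob_space M" and \<rho>: "prob_space \<rho>"
    and indep: "prob_space.indep_vars M (\<lambda>_. borel) eps {..<n}"
    and meas: "\<And>j. j < n \<Longrightarrow> eps j \<in> borel_measurable M"
    and sq: "\<And>j. j < n \<Longrightarrow> integrable M (\<lambda>w. (eps j w)\<^sup>2)"
    and mean: "\<And>j. j < n \<Longrightarrow> prob_space.expectation M (eps j) = 0"
    and var: "\<And>j. j < n \<Longrightarrow> prob_space.variance M (eps j) = \<sigma>\<^sup>2"
    and \<psi>_L2: "\<And>i. i \<ge> 1 \<Longrightarrow> \<psi> i \<in> L2 \<rho>"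
    and \<psi>_orth: "\<And>i j. i \<ge> 1 \<Longrightarrow> j \<ge> 1 \<Longrightarrow> L2_inner \<rho> (\<psi> i) (\<psi> j) = (if i = j then 1 else 0)"
    and lam: "\<And>i. i \<ge> 1 \<Longrightarrow> lam i > 0" "\<And>i. i \<ge> 1 \<Longrightarrow> lam i \<le> C" and "\<beta>' \<ge> 0"
    and W: "mat_inverse (K_tail_reg p lam \<psi> \<beta> \<gamma> n 0 x) = Some W" "W \<in> carrier_mat n n"
    and summ: "summable (\<lambda>m. (p (Suc m))\<^sup>2 * lam (Suc m) powr (2 * \<beta> - \<beta>') * (\<Sum>j<n. (\<psi> (Suc m) (x j))\<^sup>2))"
  shows "variance_term M eps \<rho> p lam \<psi> \<beta> \<beta>' \<gamma> n x
    = (\<Sum>m. ennreal (\<sigma>\<^sup>2 * ((p (Suc m))\<^sup>2 * lam (Suc m) powr (2 * \<beta> - \<beta>')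
        * (\<Sum>l<n. (\<Sum>j<n. W $$ (j, l) * \<psi> (Suc m) (x j))\<^sup>2))))"
proof -
  interpret M: prob_space M by fact
  \<comment> \<open>Half the norm weight, \<open>lam i powr (\<beta>' / 2)\<close>, is split off
    from \<open>lam i powr \<beta>\<close>; what remains enters the coefficients that the norm of
    order \<open>\<beta>'\<close> measures.\<close>
  define c where "c = (\<lambda>i. p i * lam i powr (\<beta> - \<beta>' / 2))"
  \<comment> \<open>The coefficient of \<open>eps l\<close> in the pairing of
    \<open>\<theta>\<close> with the values of \<open>\<psi> i\<close>; the sum runs over the row
    index of \<open>W\<close>, so the transpose of \<open>W\<close> acts.\<close>
  define w where "w = (\<lambda>i l. \<Sum>j<n. W $$ (j, l) * \<psi> i (x j))"
  have c2: "(c i)\<^sup>2 = (p i)\<^sup>2 * lam i powr (2 * \<beta> - \<beta>')" for i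
    by (simp add: c_def power_mult_distrib power2_eq_square flip: powr_add)
  have norm_eq: "(Hs_norm \<rho> lam \<psi> \<beta>' (fhat \<rho> p lam \<psi> \<beta> \<gamma> n x (Matrix.vec n (\<lambda>j. eps j \<omega>))))\<^sup>2
      = (\<Sum>m. ennreal ((c (Suc m) * (\<Sum>l<n. w (Suc m) l * eps l \<omega>))\<^sup>2))" for \<omega>
  proof -
    define \<theta> where "\<theta> = W *\<^sub>v Matrix.vec n (\<lambda>j. eps j \<omega>)"
    have \<theta>: "\<theta> $ j = (\<Sum>l<n. W $$ (j, l) * eps l \<omega>)" if "j < n" for j
      using that W(2) by (simp add: \<theta>_def scalar_prod_def lessThan_atLeast0)
    have pair: "(\<Sum>j<n. \<theta> $ j * \<psi> i (x j)) = (\<Sum>l<n. w i l * eps l \<omega>)" for i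
    proof -
      have "(\<Sum>j<n. \<theta> $ j * \<psi> i (x j)) = (\<Sum>j<n. \<Sum>l<n. W $$ (j, l) * eps l \<omega> * \<psi> i (x j))"
        by (simp add: \<theta> sum_distrib_right)
      also have "\<dots> = (\<Sum>l<n. \<Sum>j<n. W $$ (j, l) * eps l \<omega> * \<psi> i (x j))"
        by (rule sum.swap)
      finally show ?thesis by (simp add: w_def sum_distrib_right sum_distrib_left mult_ac)
    qed
    define a where "a = (\<lambda>i. c i * (\<Sum>l<n. w i l * eps l \<omega>))"
    have "fhat \<rho> p lam \<psi> \<beta> \<gamma> n x (Matrix.vec n (\<lambda>j. eps j \<omega>))
        = L2_suminf \<rho> (\<lambda>i s. p i * lam i powr \<beta> * (\<Sum>j<n. \<theta> $ j * \<psi> i (x j)) * \<psi> i s)"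
      unfolding fhat_def W(1) by (simp add: \<theta>_def)
    also have "(\<lambda>i s. p i * lam i powr \<beta> * (\<Sum>j<n. \<theta> $ j * \<psi> i (x j)) * \<psi> i s)
        = (\<lambda>i s. a i * lam i powr (\<beta>' / 2) * \<psi> i s)"
    proof (intro ext)
      fix i s
      have "lam i powr \<beta> = lam i powr (\<beta> - \<beta>' / 2) * lam i powr (\<beta>' / 2)"
        by (simp flip: powr_add)
      then show "p i * lam i powr \<beta> * (\<Sum>j<n. \<theta> $ j * \<psi> i (x j)) * \<psi> i s
          = a i * lam i powr (\<beta>' / 2) * \<psi> i s"
        by (simp add: a_def c_def pair mult_ac)
    qed
    finally have fhat: "fhat \<rho> p lam \<psi> \<beta> \<gamma> n x (Matrix.vec n (\<lambda>j. eps j \<omega>))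
        = L2_suminf \<rho> (\<lambda>i s. a i * lam i powr (\<beta>' / 2) * \<psi> i s)" .
    \<comment> \<open>Cauchy-Schwarz over the sample separates the random \<open>\<theta>\<close>
      from the series in \<open>summ\<close>, so square summability holds for every noise
      outcome.\<close>
    have "(a (Suc m))\<^sup>2 \<le> (\<Sum>j<n. (\<theta> $ j)\<^sup>2)
        * ((p (Suc m))\<^sup>2 * lam (Suc m) powr (2 * \<beta> - \<beta>') * (\<Sum>j<n. (\<psi> (Suc m) (x j))\<^sup>2))" for m
    proof -
      have "(a (Suc m))\<^sup>2 = (c (Suc m))\<^sup>2 * (\<Sum>j<n. \<theta> $ j * \<psi> (Suc m) (x j))\<^sup>2"
        by (simp add: a_def pair power_mult_distrib)
      also have "\<dots> \<le> (c (Suc m))\<^sup>2 * ((\<Sum>j<n. (\<theta> $ j)\<^sup>2) * (\<Sum>j<n. (\<psi> (Suc m) (x j))\<^sup>2))"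
        by (intro mult_left_mono Cauchy_Schwarz_ineq_sum) simp
      finally show ?thesis by (simp add: c2 mult_ac)
    qed
    then have "summable (\<lambda>m. (a (Suc m))\<^sup>2)"
      by (intro summable_comparison_test'[OF summable_mult[OF summ]]) auto
    from Hs_norm_L2_suminf[OF \<psi>_L2 \<psi>_orth \<rho> lam \<open>\<beta>' \<ge> 0\<close> this]
    have "(Hs_norm \<rho> lam \<psi> \<beta>' (L2_suminf \<rho> (\<lambda>i s. a i * lam i powr (\<beta>' / 2) * \<psi> i s)))\<^sup>2
        = (\<Sum>m. ennreal ((a (Suc m))\<^sup>2))" .
    then show ?thesis unfolding fhat by (simp add: a_def)
  qed
  have "variance_term M eps \<rho> p lam \<psi> \<beta> \<beta>' \<gamma> n x
      = (\<integral>\<^sup>+ \<omega>. (\<Sum>m. ennreal ((c (Suc m) * (\<Sum>l<n. w (Suc m) l * eps l \<omega>))\<^sup>2)) \<partial>M)"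
    unfolding variance_term_def norm_eq ..
  also have "\<dots> = (\<Sum>m. \<integral>\<^sup>+ \<omega>. ennreal ((c (Suc m) * (\<Sum>l<n. w (Suc m) l * eps l \<omega>))\<^sup>2) \<partial>M)"
  proof (intro nn_integral_suminf)
    have [measurable]: "(\<lambda>\<omega>. \<Sum>l<n. w i l * eps l \<omega>) \<in> borel_measurable M" for i
      by (intro borel_measurable_sum borel_measurable_times borel_measurable_const meas) simp
    show "(\<lambda>\<omega>. ennreal ((c (Suc m) * (\<Sum>l<n. w (Suc m) l * eps l \<omega>))\<^sup>2)) \<in> borel_measurable M" for m
      by measurable
  qed
  also have "\<dots> = (\<Sum>m. ennreal (\<sigma>\<^sup>2 * ((c (Suc m))\<^sup>2 * (\<Sum>l<n. (w (Suc m) l)\<^sup>2))))"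
  proof (rule suminf_cong)
    fix m
    have "(\<integral>\<^sup>+ \<omega>. ennreal ((\<Sum>l<n. (c (Suc m) * w (Suc m) l) * eps l \<omega>)\<^sup>2) \<partial>M)
        = ennreal (\<sigma>\<^sup>2 * (\<Sum>l<n. (c (Suc m) * w (Suc m) l)\<^sup>2))"
      by (rule M.second_moment_linear_combination[OF indep meas sq mean var])
    then show "(\<integral>\<^sup>+ \<omega>. ennreal ((c (Suc m) * (\<Sum>l<n. w (Suc m) l * eps l \<omega>))\<^sup>2) \<partial>M)
        = ennreal (\<sigma>\<^sup>2 * ((c (Suc m))\<^sup>2 * (\<Sum>l<n. (w (Suc m) l)\<^sup>2)))"
      by (simp add: sum_distrib_left power_mult_distrib mult.assoc)
  qed
  finally show ?thesis by (simp add: c2 w_def)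
qed

text \<open>A separate case because the series assumed summable in \<open>variance_term_eq\<close>
  may diverge here. Zero variance makes the noise vanish almost surely, and the estimator is then
  the zero series.\<close>

lemma variance_term_noiseless:
  assumes M: "prob_space M" and \<rho>: "prob_space \<rho>"
    and meas: "\<And>j. j < n \<Longrightarrow> eps j \<in> borel_measurable M"
    and sq: "\<And>j. j < n \<Longrightarrow> integrable M (\<lambda>w. (eps j w)\<^sup>2)"
    and mean: "\<And>j. j < n \<Longrightarrow> prob_space.expectation M (eps j) = 0"
    and var: "\<And>j. j < n \<Longrightarrow> prob_space.variance M (eps j) = 0"
    and \<psi>_L2: "\<And>i. i \<ge> 1 \<Longrightarrow> \<psi> i \<in> L2 \<rho>"
    and \<psi>_orth: "\<And>i j. i \<ge> 1 \<Longrightarrow> j \<ge> 1 \<Longrightarrow> L2_inner \<rho> (\<psi> i) (\<psi> j) = (if i = j then 1 else 0)"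
    and lam: "\<And>i. i \<ge> 1 \<Longrightarrow> lam i > 0" "\<And>i. i \<ge> 1 \<Longrightarrow> lam i \<le> C" and "\<beta>' \<ge> 0"
    and W: "mat_inverse (K_tail_reg p lam \<psi> \<beta> \<gamma> n 0 x) = Some W" "W \<in> carrier_mat n n"
  shows "variance_term M eps \<rho> p lam \<psi> \<beta> \<beta>' \<gamma> n x = 0"
proof -
  interpret M: prob_space M by fact
  have "AE \<omega> in M. eps j \<omega> = 0" if "j < n" for j
  proof -
    have "(\<integral>\<omega>. (eps j \<omega>)\<^sup>2 \<partial>M) = 0" using var[OF that] mean[OF that] by simp
    then show ?thesis
      using integral_nonneg_eq_0_iff_AE[OF sq[OF that]] by simp
  qed
  then have null: "AE \<omega> in M. \<forall>j\<in>{..<n}. eps j \<omega> = 0" by (subst AE_finite_all) auto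
  have "(Hs_norm \<rho> lam \<psi> \<beta>' (fhat \<rho> p lam \<psi> \<beta> \<gamma> n x (Matrix.vec n (\<lambda>j. eps j \<omega>))))\<^sup>2 = 0"
    if "\<forall>j\<in>{..<n}. eps j \<omega> = 0" for \<omega>
  proof -
    have "(W *\<^sub>v Matrix.vec n (\<lambda>j. eps j \<omega>)) $ j = 0" if "j < n" for j
      using that W(2) \<open>\<forall>j\<in>{..<n}. eps j \<omega> = 0\<close> by (auto simp: scalar_prod_def intro!: sum.neutral)
    then have fhat: "fhat \<rho> p lam \<psi> \<beta> \<gamma> n x (Matrix.vec n (\<lambda>j. eps j \<omega>))
        = L2_suminf \<rho> (\<lambda>i s. 0 * lam i powr (\<beta>' / 2) * \<psi> i s)"
      unfolding fhat_def W(1) by simp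
    show ?thesis
      unfolding fhat
      by (subst Hs_norm_L2_suminf[OF \<psi>_L2 \<psi>_orth \<rho> lam \<open>\<beta>' \<ge> 0\<close>]) simp_all
  qed
  with null have "AE \<omega> in M. (Hs_norm \<rho> lam \<psi> \<beta>' (fhat \<rho> p lam \<psi> \<beta> \<gamma> n x (Matrix.vec n (\<lambda>j. eps j \<omega>))))\<^sup>2 = 0"
    by (rule eventually_mono)
  from nn_integral_cong_AE[OF this] show ?thesis
    unfolding variance_term_def by simp
qed

section \<open>Form bounds for the regularised kernel matrices\<close>

lemma dot_K_tail_reg:
  assumes "n \<ge> 1"
  shows "dot n v (app n (mat_fun (K_tail_reg p lam \<psi> \<beta> \<gamma> n k x)) v)
    = real n * (dot n v (app n (mat_fun ((1 / real n) \<cdot>\<^sub>m K_tail p lam \<psi> \<beta> n k x)) v) + \<gamma> * dot n v v)"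
    (is "dot n v (app n ?A v) = real n * (dot n v (app n ?B v) + _)")
proof -
  have "app n ?A v i = real n * (app n ?B v i + \<gamma> * v i)" if "i < n" for i
    using that assms unfolding K_tail_reg_def
    by (simp add: app_add_scaled_identity[OF K_tail_carrier] app_smult_mat[OF K_tail_carrier] algebra_simps)
  then have "dot n v (app n ?A v) = dot n v (\<lambda>i. real n * (app n ?B v i + \<gamma> * v i))"
    by (intro dot_cong) simp_all
  then show ?thesis
    unfolding dot_scale_right dot_add_right by simp
qed

lemma K_tail_reg_form_bounds:
  assumes n: "n \<ge> 1" and pd: "pos_def n (K_tail_reg p lam \<psi> \<beta> \<gamma> n k x)"
  defines "B \<equiv> (1 / real n) \<cdot>\<^sub>m K_tail p lam \<psi> \<beta> n k x"
  shows K_tail_reg_eig_pos: "0 < eig n B + \<gamma>"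
    and K_tail_reg_form_ge: "real n * (eig n B + \<gamma>) * dot n v v
      \<le> dot n v (app n (mat_fun (K_tail_reg p lam \<psi> \<beta> \<gamma> n k x)) v)"
    and K_tail_reg_form_le: "dot n v (app n (mat_fun (K_tail_reg p lam \<psi> \<beta> \<gamma> n k x)) v)
      \<le> real n * (eig 1 B + \<gamma>) * dot n v v"
    and eig_least_le_greatest: "eig n B \<le> eig 1 B"
proof -
  have B: "B \<in> carrier_mat n n" "transpose_mat B = B"
    by (auto simp: B_def K_tail_carrier K_tail_symm intro!: eq_matI)
      (auto simp: K_tail_def Let_def mult_ac)
  note form = dot_K_tail_reg[OF n, of _ p lam \<psi> \<beta> \<gamma> k x, folded B_def]
  show "real n * (eig n B + \<gamma>) * dot n v v
      \<le> dot n v (app n (mat_fun (K_tail_reg p lam \<psi> \<beta> \<gamma> n k x)) v)"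
    using mult_left_mono[OF eig_least_le_form[OF B n, of v], of "real n"] unfolding form
    by (simp add: algebra_simps)
  show "dot n v (app n (mat_fun (K_tail_reg p lam \<psi> \<beta> \<gamma> n k x)) v)
      \<le> real n * (eig 1 B + \<gamma>) * dot n v v"
    using mult_left_mono[OF form_le_eig_greatest[OF B n, of v], of "real n"] unfolding form
    by (simp add: algebra_simps)
  have ev: "eigenvalue B (eig n B)" by (rule eigenvalue_eig[OF B]) (use n in auto)
  then show "eig n B \<le> eig 1 B" by (rule eig_greatest[OF B])
  \<comment> \<open>Positive definiteness is tested at an eigenvector for the least eigenvalue of
    \<open>B\<close>, where the form is
    \<open>real n * ((eig n B + \<gamma>) * dot n y y)\<close>.\<close>
  obtain y where y: "dot n y y > 0" "\<forall>i<n. app n (mat_fun B) y i = eig n B * y i"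
    by (rule eigenvalue_mat_funE[OF B(1) ev])
  let ?A = "K_tail_reg p lam \<psi> \<beta> \<gamma> n k x"
  have "dot n y (app n (mat_fun B) y) = dot n y (\<lambda>i. eig n B * y i)"
    by (rule dot_cong) (use y(2) in auto)
  then have Ay: "dot n y (app n (mat_fun ?A) y) = real n * ((eig n B + \<gamma>) * dot n y y)"
    unfolding form dot_scale_right by (simp add: algebra_simps)
  have "Matrix.vec n y \<noteq> 0\<^sub>v n"
  proof
    assume "Matrix.vec n y = 0\<^sub>v n"
    then have "Matrix.vec n y $ i = 0\<^sub>v n $ i" for i by simp
    then have "\<forall>i<n. y i = 0" by (metis index_vec index_zero_vec(1))
    then show False using y(1) by (simp add: dot_def)
  qed
  then have "0 < scalar_prod (Matrix.vec n y) (?A *\<^sub>v Matrix.vec n y)"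
    using pd unfolding pos_def_def by simp
  also have "scalar_prod (Matrix.vec n y) (?A *\<^sub>v Matrix.vec n y) = dot n y (app n (mat_fun ?A) y)"
    using K_tail_reg_carrier[of p lam \<psi> \<beta> \<gamma> n k x]
    by (simp add: scalar_prod_def dot_def app_def mat_fun_def lessThan_atLeast0)
  finally have "0 < real n * ((eig n B + \<gamma>) * dot n y y)" unfolding Ay .
  then show "0 < eig n B + \<gamma>"
    using n y(1) by (simp add: zero_less_mult_iff)
qed

text \<open>The head adds the squares \<open>(dot n (\<lambda>l. \<psi> i (x l)) v)\<^sup>2\<close>
  with nonnegative weights, so the lower bound of the tail survives for the full matrix.\<close>

lemma K_reg_form_ge:
  assumes n: "n \<ge> 1" and pd: "pos_def n (K_tail_reg p lam \<psi> \<beta> \<gamma> n k x)"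
    and summ: "\<And>j l. j < n \<Longrightarrow> l < n \<Longrightarrow> summable (\<lambda>m. (p (Suc m))\<^sup>2 * lam (Suc m) powr \<beta>
          * \<psi> (Suc m) (x j) * \<psi> (Suc m) (x l))"
  defines "B \<equiv> (1 / real n) \<cdot>\<^sub>m K_tail p lam \<psi> \<beta> n k x"
  shows "real n * (eig n B + \<gamma>) * dot n v v \<le> dot n v (app n (mat_fun (K_tail_reg p lam \<psi> \<beta> \<gamma> n 0 x)) v)"
proof -
  let ?d = "\<lambda>i. (p i)\<^sup>2 * lam i powr \<beta>" and ?q = "\<lambda>i l. \<psi> i (x l)"
  have "dot n v (app n (mat_fun (K_tail_reg p lam \<psi> \<beta> \<gamma> n 0 x)) v)
      = dot n v (\<lambda>j. app n (mat_fun (K_tail_reg p lam \<psi> \<beta> \<gamma> n k x)) v j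
          + (\<Sum>i=1..k. ?d i * dot n (?q i) v * ?q i j))"
    by (intro dot_cong refl app_K_tail_split summ)
  also have "\<dots> = dot n v (app n (mat_fun (K_tail_reg p lam \<psi> \<beta> \<gamma> n k x)) v)
      + dot n v (\<lambda>j. \<Sum>i=1..k. ?d i * dot n (?q i) v * ?q i j)"
    by (rule dot_add_right)
  also have "dot n v (\<lambda>j. \<Sum>i=1..k. ?d i * dot n (?q i) v * ?q i j)
      = (\<Sum>i=1..k. ?d i * dot n (?q i) v * dot n (?q i) v)"
    unfolding dot_def[of n v] sum_distrib_left
    by (subst sum.swap) (simp add: dot_def sum_distrib_left mult_ac)
  finally have "dot n v (app n (mat_fun (K_tail_reg p lam \<psi> \<beta> \<gamma> n k x)) v)
      \<le> dot n v (app n (mat_fun (K_tail_reg p lam \<psi> \<beta> \<gamma> n 0 x)) v)"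
    by (simp add: sum_nonneg mult.assoc)
  with K_tail_reg_form_ge[OF n pd, of v, folded B_def] show ?thesis by linarith
qed

text \<open>The Gram matrix has size \<open>k\<close>, so its \<open>k\<close>-th eigenvalue is the
  least one, and its quadratic form is the squared norm of a combination of feature columns.\<close>

lemma eig_gram:
  fixes \<psi> :: "nat \<Rightarrow> 'x \<Rightarrow> real" and x :: "nat \<Rightarrow> 'x" and n k :: nat
  assumes "k \<ge> 1"
  defines "\<mu> \<equiv> eig k (transpose_mat (Psi_le \<psi> n k x) * Psi_le \<psi> n k x)"
  shows eig_gram_nonneg: "0 \<le> \<mu>"
    and eig_gram_le: "\<mu> * (\<Sum>l=1..k. (u l)\<^sup>2) \<le> (\<Sum>j<n. (\<Sum>l=1..k. u l * \<psi> l (x j))\<^sup>2)"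
proof -
  let ?G = "transpose_mat (Psi_le \<psi> n k x) * Psi_le \<psi> n k x"
  have P: "Psi_le \<psi> n k x \<in> carrier_mat n k" by (simp add: Psi_le_def)
  have G: "?G \<in> carrier_mat k k" using P by simp
  have sym: "transpose_mat ?G = ?G"
    using P by (subst transpose_mult[of _ k n _ k]) auto
  have entry: "?G $$ (a, b) = (\<Sum>j<n. \<psi> (Suc a) (x j) * \<psi> (Suc b) (x j))" if "a < k" "b < k" for a b
    using that by (simp add: Psi_le_def scalar_prod_def lessThan_atLeast0)
  have form: "dot k v (app k (mat_fun ?G) v) = (\<Sum>j<n. (\<Sum>a<k. v a * \<psi> (Suc a) (x j))\<^sup>2)" for v
  proof -
    have "dot k v (app k (mat_fun ?G) v)
        = (\<Sum>a<k. v a * (\<Sum>b<k. (\<Sum>j<n. \<psi> (Suc a) (x j) * \<psi> (Suc b) (x j)) * v b))"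
      unfolding dot_def app_def mat_fun_def
      by (intro sum.cong refl arg_cong2[where f = "(*)"]) (simp_all add: entry del: index_mult_mat)
    also have "\<dots> = (\<Sum>a<k. \<Sum>b<k. \<Sum>j<n. v a * \<psi> (Suc a) (x j) * (v b * \<psi> (Suc b) (x j)))"
      by (simp add: sum_distrib_left sum_distrib_right mult_ac)
    also have "\<dots> = (\<Sum>a<k. \<Sum>j<n. \<Sum>b<k. v a * \<psi> (Suc a) (x j) * (v b * \<psi> (Suc b) (x j)))"
      by (intro sum.cong refl sum.swap)
    also have "\<dots> = (\<Sum>j<n. \<Sum>a<k. \<Sum>b<k. v a * \<psi> (Suc a) (x j) * (v b * \<psi> (Suc b) (x j)))"
      by (rule sum.swap)
    finally show ?thesis by (simp add: power2_eq_square sum_product)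
  qed
  have "\<mu> * dot k (\<lambda>a. u (Suc a)) (\<lambda>a. u (Suc a)) \<le> (\<Sum>j<n. (\<Sum>a<k. u (Suc a) * \<psi> (Suc a) (x j))\<^sup>2)"
    unfolding \<mu>_def form[symmetric] by (rule eig_least_le_form[OF G sym \<open>k \<ge> 1\<close>])
  then show "\<mu> * (\<Sum>l=1..k. (u l)\<^sup>2) \<le> (\<Sum>j<n. (\<Sum>l=1..k. u l * \<psi> l (x j))\<^sup>2)"
    by (simp add: dot_self sum.atLeast1_atMost_eq)
  have ev: "eigenvalue ?G \<mu>"
    unfolding \<mu>_def by (rule eigenvalue_eig[OF G sym]) (use \<open>k \<ge> 1\<close> in auto)
  obtain y where y: "dot k y y > 0" "\<forall>i<k. app k (mat_fun ?G) y i = \<mu> * y i"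
    by (rule eigenvalue_mat_funE[OF G ev])
  have "dot k y (app k (mat_fun ?G) y) = dot k y (\<lambda>i. \<mu> * y i)"
    by (rule dot_cong) (use y(2) in auto)
  then have "\<mu> * dot k y y = (\<Sum>j<n. (\<Sum>a<k. y a * \<psi> (Suc a) (x j))\<^sup>2)"
    unfolding form dot_scale_right by simp
  then have "0 \<le> \<mu> * dot k y y" by (simp add: sum_nonneg)
  then show "0 \<le> \<mu>" using y(1) by (simp add: zero_le_mult_iff)
qed

text \<open>The Gram form is tested at the \<open>i\<close>-th unit vector. This later trades a
  factor \<open>1 / \<mu>\<close> for the squared column norm over \<open>\<mu>\<^sup>2\<close>, the
  shape of the head term.\<close>

lemma eig_gram_le_column:
  assumes "i \<in> {1..k}"
  shows "eig k (transpose_mat (Psi_le \<psi> n k x) * Psi_le \<psi> n k x) \<le> (\<Sum>j<n. (\<psi> i (x j))\<^sup>2)"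
proof -
  let ?e = "\<lambda>l. if l = i then 1 else 0 :: real"
  have "(\<Sum>l=1..k. (?e l)\<^sup>2) = (\<Sum>l=1..k. if l = i then 1 else 0)"
    by (intro sum.cong refl) auto
  then have norm: "(\<Sum>l=1..k. (?e l)\<^sup>2) = 1" using assms by simp
  have "(\<Sum>l=1..k. ?e l * \<psi> l (x j)) = (\<Sum>l=1..k. if l = i then \<psi> i (x j) else 0)" for j
    by (intro sum.cong refl) auto
  then have col: "(\<Sum>l=1..k. ?e l * \<psi> l (x j)) = \<psi> i (x j)" for j using assms by simp
  have "k \<ge> 1" using assms by simp
  from eig_gram_le[OF this, of \<psi> n x ?e] show ?thesis unfolding norm col by simp
qed

text \<open>Transposing \<open>W * A = 1\<^sub>m n\<close> for symmetric \<open>A\<close> shows that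
  the transpose of \<open>W\<close> is a right inverse of \<open>A\<close>.\<close>

lemma app_transpose_inverse:
  assumes A: "A \<in> carrier_mat n n" "transpose_mat A = A"
    and W: "W \<in> carrier_mat n n" "W * A = 1\<^sub>m n" and "i < n"
  shows "app n (mat_fun A) (\<lambda>l. \<Sum>j<n. W $$ (j, l) * q j) i = q i"
proof -
  have sym: "A $$ (i, l) = A $$ (l, i)" if "l < n" for l
    using symm_mat_fun[OF A] \<open>i < n\<close> that by (auto simp: symm_def mat_fun_def)
  have entry: "(\<Sum>l<n. W $$ (j, l) * A $$ (l, i)) = (if j = i then 1 else 0)" if "j < n" for j
  proof -
    have "(W * A) $$ (j, i) = (\<Sum>l<n. W $$ (j, l) * A $$ (l, i))"
      using A W(1) that \<open>i < n\<close> by (simp add: scalar_prod_def lessThan_atLeast0)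
    then show ?thesis using W(2) that \<open>i < n\<close> by simp
  qed
  have "app n (mat_fun A) (\<lambda>l. \<Sum>j<n. W $$ (j, l) * q j) i
      = (\<Sum>l<n. \<Sum>j<n. q j * (W $$ (j, l) * A $$ (l, i)))"
    unfolding app_def mat_fun_def sum_distrib_left
    by (intro sum.cong refl) (simp add: sym mult_ac)
  also have "\<dots> = (\<Sum>j<n. \<Sum>l<n. q j * (W $$ (j, l) * A $$ (l, i)))"
    by (rule sum.swap)
  also have "\<dots> = (\<Sum>j<n. if j = i then q j else 0)"
    unfolding sum_distrib_left[symmetric] by (intro sum.cong refl) (simp add: entry)
  finally show ?thesis using \<open>i < n\<close> by simp
qed

text \<open>Indices beyond \<open>k\<close> use coercivity of the full matrix, the first
  \<open>k\<close> the perturbation estimate. The head carries only the first power of the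
  eigenvalue ratio, later dominated by the squared concentration coefficient.\<close>

lemma variance_series_bound:
  fixes p lam :: "nat \<Rightarrow> real" and \<psi> :: "nat \<Rightarrow> 'x \<Rightarrow> real" and x :: "nat \<Rightarrow> 'x"
    and \<beta> \<beta>' \<gamma> :: real and n k :: nat
  assumes n: "n \<ge> 1" and k: "k \<ge> 1" and pd: "pos_def n (K_tail_reg p lam \<psi> \<beta> \<gamma> n k x)"
    and summ: "\<And>j l. j < n \<Longrightarrow> l < n \<Longrightarrow> summable (\<lambda>m. (p (Suc m))\<^sup>2 * lam (Suc m) powr \<beta>
          * \<psi> (Suc m) (x j) * \<psi> (Suc m) (x l))"
    and p: "\<And>i. i \<ge> 1 \<Longrightarrow> p i \<noteq> 0" and lam: "\<And>i. i \<ge> 1 \<Longrightarrow> lam i > 0"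
    and W: "W \<in> carrier_mat n n" "W * K_tail_reg p lam \<psi> \<beta> \<gamma> n 0 x = 1\<^sub>m n"
    and tail: "summable (\<lambda>m. (p (k + Suc m))\<^sup>2 * lam (k + Suc m) powr (2 * \<beta> - \<beta>')
          * (\<Sum>j<n. (\<psi> (k + Suc m) (x j))\<^sup>2))"
  defines "B \<equiv> (1 / real n) \<cdot>\<^sub>m K_tail p lam \<psi> \<beta> n k x"
    and "\<mu> \<equiv> eig k (transpose_mat (Psi_le \<psi> n k x) * Psi_le \<psi> n k x)"
  assumes \<mu>: "\<mu> \<noteq> 0"
  defines "g \<equiv> \<lambda>i. (p i)\<^sup>2 * lam i powr (2 * \<beta> - \<beta>') * (\<Sum>l<n. (\<Sum>j<n. W $$ (j, l) * \<psi> i (x j))\<^sup>2)"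
  shows "summable (\<lambda>m. g (Suc m))"
    and "(\<Sum>m. g (Suc m)) \<le> (eig 1 B + \<gamma>) / (eig n B + \<gamma>)
        * ((\<Sum>j<n. \<Sum>i=1..k. 1 / (p i)\<^sup>2 * lam i powr (- \<beta>') * (\<psi> i (x j))\<^sup>2) / \<mu>\<^sup>2)
      + (\<Sum>m. (p (k + Suc m))\<^sup>2 * lam (k + Suc m) powr (2 * \<beta> - \<beta>') * (\<Sum>j<n. (\<psi> (k + Suc m) (x j))\<^sup>2))
        / (real n * (eig n B + \<gamma>))\<^sup>2"
proof -
  define m where "m = real n * (eig n B + \<gamma>)"
  define L where "L = real n * (eig 1 B + \<gamma>)"
  define q where "q = (\<lambda>i j. \<psi> i (x j))"
  define w where "w = (\<lambda>i l. \<Sum>j<n. W $$ (j, l) * q i j)"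
  define d where "d = (\<lambda>i. (p i)\<^sup>2 * lam i powr \<beta>)"
  define c where "c = (\<lambda>i. (p i)\<^sup>2 * lam i powr (2 * \<beta> - \<beta>'))"
  define r where "r = (\<lambda>i. 1 / (p i)\<^sup>2 * lam i powr (- \<beta>'))"
  have Lm: "L / m = (eig 1 B + \<gamma>) / (eig n B + \<gamma>)"
    using n by (simp add: L_def m_def)
  have g: "g i = c i * dot n (w i) (w i)" for i
    by (simp add: g_def c_def w_def q_def dot_self)
  have c0: "0 \<le> c i" for i by (simp add: c_def)
  have m0: "0 < m"
    using K_tail_reg_eig_pos[OF n pd] n by (simp add: m_def B_def)
  have mL: "m \<le> L"
    using eig_least_le_greatest[OF n pd] by (simp add: m_def L_def B_def mult_left_mono)
  have \<mu>0: "0 < \<mu>" using eig_gram_nonneg[OF k] \<mu> by (simp add: \<mu>_def order_less_le)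
  have ge0: "m * dot n v v \<le> dot n v (app n (mat_fun (K_tail_reg p lam \<psi> \<beta> \<gamma> n 0 x)) v)" for v
    unfolding m_def B_def by (intro K_reg_form_ge n pd summ)
  have sol: "app n (mat_fun (K_tail_reg p lam \<psi> \<beta> \<gamma> n 0 x)) (w i) j = q i j" if "j < n" for i j
    unfolding w_def by (rule app_transpose_inverse[OF K_tail_reg_carrier K_tail_reg_symm W that])
  have tail_le: "g i \<le> c i * (\<Sum>j<n. (\<psi> i (x j))\<^sup>2) / m\<^sup>2" for i
    using mult_left_mono[OF norm_solution_le[OF m0 ge0 sol] c0, of i i]
    by (simp add: g dot_self q_def)
  have head_le: "g i \<le> L / m * (r i * (\<Sum>j<n. (\<psi> i (x j))\<^sup>2) / \<mu>\<^sup>2)" if "i \<in> {1..k}" for i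
  proof -
    have i: "i \<ge> 1" using that by simp
    have d0: "0 < d i" using p[OF i] lam[OF i] by (simp add: d_def)
    have gram: "\<mu> * (\<Sum>l=1..k. (u l)\<^sup>2) \<le> (\<Sum>j<n. (\<Sum>l=1..k. u l * q l j)\<^sup>2)" for u
      unfolding \<mu>_def q_def by (rule eig_gram_le[OF k])
    have "dot n (w i) (w i) \<le> L / (m * \<mu> * (d i)\<^sup>2)"
    proof (rule norm_perturbed_solution_le[where a = "mat_fun (K_tail_reg p lam \<psi> \<beta> \<gamma> n k x)"
          and I = "{1..k}" and d = d and q = q])
      show "symm n (mat_fun (K_tail_reg p lam \<psi> \<beta> \<gamma> n k x))"
        by (rule symm_mat_fun[OF K_tail_reg_carrier K_tail_reg_symm])
      show "m * dot n v v \<le> dot n v (app n (mat_fun (K_tail_reg p lam \<psi> \<beta> \<gamma> n k x)) v)" for v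
        unfolding m_def B_def by (rule K_tail_reg_form_ge[OF n pd])
      show "dot n v (app n (mat_fun (K_tail_reg p lam \<psi> \<beta> \<gamma> n k x)) v) \<le> L * dot n v v" for v
        unfolding L_def B_def by (rule K_tail_reg_form_le[OF n pd])
      show "0 < d l" if "l \<in> {1..k}" for l using p[of l] lam[of l] that by (simp add: d_def)
      show "app n (mat_fun (K_tail_reg p lam \<psi> \<beta> \<gamma> n k x)) (w i) j
          + (\<Sum>l=1..k. d l * dot n (q l) (w i) * q l j) = q i j" if "j < n" for j
      proof -
        have "app n (mat_fun (K_tail_reg p lam \<psi> \<beta> \<gamma> n 0 x)) (w i) j
            = app n (mat_fun (K_tail_reg p lam \<psi> \<beta> \<gamma> n k x)) (w i) j
              + (\<Sum>l=1..k. (p l)\<^sup>2 * lam l powr \<beta> * dot n (\<lambda>j. \<psi> l (x j)) (w i) * \<psi> l (x j))"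
          by (intro app_K_tail_split summ that)
        then show ?thesis unfolding sol[OF that] by (simp add: d_def q_def)
      qed
    qed (use m0 mL \<mu>0 gram \<open>i \<in> {1..k}\<close> in auto)
    then have "g i \<le> c i * (L / (m * \<mu> * (d i)\<^sup>2))"
      unfolding g by (rule mult_left_mono[OF _ c0])
    \<comment> \<open>The weight factors as \<open>c i = r i * (d i)\<^sup>2\<close>, so the squared
      \<open>d i\<close> of the perturbation estimate cancels.\<close>
    also have "\<dots> = L / m * (r i / \<mu>)"
    proof -
      have "lam i powr (2 * \<beta> - \<beta>') = lam i powr (- \<beta>') * (lam i powr \<beta> * lam i powr \<beta>)"
        by (simp flip: powr_add)
      then have "c i = r i * (d i)\<^sup>2"
        using p[OF i] by (simp add: c_def r_def d_def power2_eq_square)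
      then show ?thesis using d0 by simp
    qed
    also have "\<dots> \<le> L / m * (r i * (\<Sum>j<n. (\<psi> i (x j))\<^sup>2) / \<mu>\<^sup>2)"
    proof (rule mult_left_mono)
      have "\<mu> \<le> (\<Sum>j<n. (\<psi> i (x j))\<^sup>2)" unfolding \<mu>_def by (rule eig_gram_le_column[OF that])
      then have "r i * \<mu> / \<mu>\<^sup>2 \<le> r i * (\<Sum>j<n. (\<psi> i (x j))\<^sup>2) / \<mu>\<^sup>2"
        by (intro divide_right_mono mult_left_mono) (simp_all add: r_def)
      then show "r i / \<mu> \<le> r i * (\<Sum>j<n. (\<psi> i (x j))\<^sup>2) / \<mu>\<^sup>2"
        using \<mu>0 by (simp add: power2_eq_square)
    qed (use m0 mL in auto)
    finally show ?thesis .
  qed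
  have g0: "0 \<le> g i" for i unfolding g by (intro mult_nonneg_nonneg c0) simp
  have tail': "summable (\<lambda>j. c (k + Suc j) * (\<Sum>l<n. (\<psi> (k + Suc j) (x l))\<^sup>2) / m\<^sup>2)"
    using tail unfolding c_def by (rule summable_divide)
  have "summable (\<lambda>j. g (k + Suc j))"
    by (rule summable_comparison_test'[OF tail', of 0]) (use tail_le g0 in simp)
  then have shift: "summable (\<lambda>j. g (Suc (j + k)))" by (simp add: add.commute)
  then show sg: "summable (\<lambda>j. g (Suc j))"
    by (subst (asm) summable_iff_shift[of "\<lambda>j. g (Suc j)"])
  have "(\<Sum>j. g (Suc j)) = (\<Sum>j. g (Suc (j + k))) + (\<Sum>i=1..k. g i)"
    using suminf_split_initial_segment[OF sg, of k] by (simp add: sum.atLeast1_atMost_eq)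
  also have "(\<Sum>i=1..k. g i) \<le> (\<Sum>i=1..k. L / m * (r i * (\<Sum>j<n. (\<psi> i (x j))\<^sup>2) / \<mu>\<^sup>2))"
    by (intro sum_mono head_le)
  also have "\<dots> = L / m * ((\<Sum>j<n. \<Sum>i=1..k. r i * (\<psi> i (x j))\<^sup>2) / \<mu>\<^sup>2)"
    by (subst sum.swap) (simp add: sum_distrib_left sum_divide_distrib)
  also have "(\<Sum>j. g (Suc (j + k))) \<le> (\<Sum>j. c (k + Suc j) * (\<Sum>l<n. (\<psi> (k + Suc j) (x l))\<^sup>2) / m\<^sup>2)"
    using tail_le by (intro suminf_le shift tail') (simp add: add.commute)
  also have "\<dots> = (\<Sum>j. c (k + Suc j) * (\<Sum>l<n. (\<psi> (k + Suc j) (x l))\<^sup>2)) / m\<^sup>2"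
    using tail unfolding c_def by (rule suminf_divide)
  finally have "(\<Sum>j. g (Suc j)) \<le> (\<Sum>j. c (k + Suc j) * (\<Sum>l<n. (\<psi> (k + Suc j) (x l))\<^sup>2)) / m\<^sup>2
      + L / m * ((\<Sum>j<n. \<Sum>i=1..k. r i * (\<psi> i (x j))\<^sup>2) / \<mu>\<^sup>2)" by simp
  then show "(\<Sum>m. g (Suc m)) \<le> (eig 1 B + \<gamma>) / (eig n B + \<gamma>)
        * ((\<Sum>j<n. \<Sum>i=1..k. 1 / (p i)\<^sup>2 * lam i powr (- \<beta>') * (\<psi> i (x j))\<^sup>2) / \<mu>\<^sup>2)
      + (\<Sum>m. (p (k + Suc m))\<^sup>2 * lam (k + Suc m) powr (2 * \<beta> - \<beta>') * (\<Sum>j<n. (\<psi> (k + Suc m) (x j))\<^sup>2))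
        / (real n * (eig n B + \<gamma>))\<^sup>2"
    unfolding Lm c_def r_def m_def[symmetric] by linarith
qed

section \<open>The variance bound, with its infinite and finite cases\<close>

theorem theorem3p6:
  fixes M :: "'w measure" and \<rho> :: "'x measure"
    and X :: "nat \<Rightarrow> 'w \<Rightarrow> 'x" and eps :: "nat \<Rightarrow> 'w \<Rightarrow> real"
    and evl :: "'h::{real_inner, polish_space} \<Rightarrow> 'x \<Rightarrow> real" and K :: "'x \<Rightarrow> 'x \<Rightarrow> real"
    and \<psi> :: "nat \<Rightarrow> 'x \<Rightarrow> real" and lam p :: "nat \<Rightarrow> real"
    and \<A> :: "('x \<Rightarrow> real) \<Rightarrow> 'x \<Rightarrow> real" and D :: "('x \<Rightarrow> real) set"
    and lam_exp p_exp \<beta> \<beta>' \<gamma> \<sigma> :: real and n k :: nat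
  assumes "prob_space \<rho>" and "prob_space M"
    \<comment> \<open>the sample\<close>
    and "n \<ge> 1"
    and "\<forall>j<n. X j \<in> measurable M \<rho> \<and> distr M \<rho> (X j) = \<rho>"
    and "prob_space.indep_vars M (\<lambda>_. \<rho>) X {..<n}"
    \<comment> \<open>the noise\<close>
    and "\<forall>j<n. eps j \<in> borel_measurable M \<and> distr M borel (eps j) = distr M borel (eps 0)"
    and "\<forall>j<n. integrable M (\<lambda>w. (eps j w)\<^sup>2) \<and> prob_space.expectation M (eps j) = 0
          \<and> prob_space.variance M (eps j) = \<sigma>\<^sup>2"
    and "prob_space.indep_vars M (\<lambda>_. borel) eps {..<n}"
    and "prob_space.indep_set M
          (sets (vimage_algebra (space M) (\<lambda>w. \<lambda>j\<in>{..<n}. X j w) (Pi\<^sub>M {..<n} (\<lambda>_. \<rho>))))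
          (sets (vimage_algebra (space M) (\<lambda>w. \<lambda>j\<in>{..<n}. eps j w) (Pi\<^sub>M {..<n} (\<lambda>_. borel))))"
    \<comment> \<open>the kernel and its Hilbert space\<close>
    and "L2_orthonormal_basis \<rho> \<psi>"
    and "lam_exp > 1" and "\<exists>c>0. \<forall>i\<ge>1. lam i = c * real i powr (- lam_exp)"
    and "\<forall>s\<in>space \<rho>. \<forall>t\<in>space \<rho>.
          (\<lambda>i. lam (Suc i) * \<psi> (Suc i) s * \<psi> (Suc i) t) sums K s t"
    and "is_rkhs evl (space \<rho>) K"
    \<comment> \<open>the operator\<close>
    and "self_adjoint_L2 \<rho> D \<A>"
    and "\<forall>i\<ge>1. \<psi> i \<in> D \<and> (AE s in \<rho>. \<A> (\<psi> i) s = p i * \<psi> i s)"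
    and "p_exp < 0" and "\<exists>c. c \<noteq> 0 \<and> (\<forall>i\<ge>1. p i = c * real i powr (- p_exp))"
    \<comment> \<open>the remaining parameters\<close>
    and "0 \<le> \<beta>" and "\<beta> \<le> 1" and "0 \<le> \<beta>'" and "\<beta>' \<le> \<beta>" and "\<gamma> \<ge> 0" and "k \<ge> 1"
  shows "\<forall>w\<in>space M. let x = (\<lambda>j. X j w) in
      (\<forall>j<n. \<forall>l<n. summable (\<lambda>m. (p (Suc m))\<^sup>2 * lam (Suc m) powr \<beta>
          * \<psi> (Suc m) (x j) * \<psi> (Suc m) (x l))) \<longrightarrow>
      pos_def n (K_tail_reg p lam \<psi> \<beta> \<gamma> n k x) \<longrightarrow>
      variance_term M eps \<rho> p lam \<psi> \<beta> \<beta>' \<gamma> n x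
        \<le> ennreal (\<sigma>\<^sup>2) * (rho_coeff p lam \<psi> \<beta> \<gamma> n k x)\<^sup>2 *
          (frac_inf
             (ennreal (\<Sum>j<n. \<Sum>i=1..k. 1 / (p i)\<^sup>2 * lam i powr (- \<beta>') * (\<psi> i (x j))\<^sup>2))
             (ennreal ((eig k (transpose_mat (Psi_le \<psi> n k x) * Psi_le \<psi> n k x))\<^sup>2))
           + frac_inf
             (\<Sum>j<n. \<Sum>m. (let i = k + Suc m in
                ennreal ((p i)\<^sup>2 * lam i powr (2 * \<beta> - \<beta>') * (\<psi> i (x j))\<^sup>2)))
             ((of_nat n)\<^sup>2 * (sup_tail p lam \<beta> k)\<^sup>2))"
proof (intro ballI, unfold Let_def, intro impI)
  fix \<omega> assume "\<omega> \<in> space M"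
  define x where "x = (\<lambda>j. X j \<omega>)"
  assume "\<forall>j<n. \<forall>l<n. summable (\<lambda>m. (p (Suc m))\<^sup>2 * lam (Suc m) powr \<beta>
      * \<psi> (Suc m) (X j \<omega>) * \<psi> (Suc m) (X l \<omega>))"
  then have summ: "\<And>j l. j < n \<Longrightarrow> l < n \<Longrightarrow> summable (\<lambda>m. (p (Suc m))\<^sup>2 * lam (Suc m) powr \<beta>
      * \<psi> (Suc m) (x j) * \<psi> (Suc m) (x l))"
    by (simp add: x_def)
  assume "pos_def n (K_tail_reg p lam \<psi> \<beta> \<gamma> n k (\<lambda>j. X j \<omega>))"
  then have pd: "pos_def n (K_tail_reg p lam \<psi> \<beta> \<gamma> n k x)" by (simp add: x_def)
  obtain C where C: "C > 0" "\<forall>i\<ge>1. lam i = C * real i powr (- lam_exp)"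
    using \<open>\<exists>c>0. \<forall>i\<ge>1. lam i = c * real i powr (- lam_exp)\<close> by blast
  have lam: "lam i > 0" "lam i \<le> C" if "i \<ge> 1" for i
  proof -
    show "lam i > 0" using C that by simp
    have "real i powr (- lam_exp) \<le> real i powr 0"
      using that \<open>lam_exp > 1\<close> by (intro powr_mono) auto
    then show "lam i \<le> C" using C that by simp
  qed
  have p: "p i \<noteq> 0" if "i \<ge> 1" for i
    using \<open>\<exists>c. c \<noteq> 0 \<and> (\<forall>i\<ge>1. p i = c * real i powr (- p_exp))\<close> that by auto
  have basis: "\<And>i. i \<ge> 1 \<Longrightarrow> \<psi> i \<in> L2 \<rho>"
    "\<And>i j. i \<ge> 1 \<Longrightarrow> j \<ge> 1 \<Longrightarrow> L2_inner \<rho> (\<psi> i) (\<psi> j) = (if i = j then 1 else 0)"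
    using \<open>L2_orthonormal_basis \<rho> \<psi>\<close> unfolding L2_orthonormal_basis_def by blast+
  have eps: "eps j \<in> borel_measurable M" "integrable M (\<lambda>w. (eps j w)\<^sup>2)"
    "prob_space.expectation M (eps j) = 0" "prob_space.variance M (eps j) = \<sigma>\<^sup>2" if "j < n" for j
    using assms(6,7) that by blast+
  define B where "B = (1 / real n) \<cdot>\<^sub>m K_tail p lam \<psi> \<beta> n k x"
  define e where "e = eig n B + \<gamma>"
  define \<mu> where "\<mu> = eig k (transpose_mat (Psi_le \<psi> n k x) * Psi_le \<psi> n k x)"
  define N1 where "N1 = (\<Sum>j<n. \<Sum>i=1..k. 1 / (p i)\<^sup>2 * lam i powr (- \<beta>') * (\<psi> i (x j))\<^sup>2)"
  define f where "f = (\<lambda>j m. (p (k + Suc m))\<^sup>2 * lam (k + Suc m) powr (2 * \<beta> - \<beta>') * (\<psi> (k + Suc m) (x j))\<^sup>2)"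
  define S where "S = sup_tail p lam \<beta> k"
  define T1 where "T1 = frac_inf (ennreal N1) (ennreal (\<mu>\<^sup>2))"
  define T2 where "T2 = frac_inf (\<Sum>j<n. \<Sum>m. ennreal (f j m)) ((of_nat n)\<^sup>2 * S\<^sup>2)"
  have e0: "0 < e" unfolding e_def B_def by (rule K_tail_reg_eig_pos[OF \<open>n \<ge> 1\<close> pd])
  have "real n * e > 0" using e0 \<open>n \<ge> 1\<close> by simp
  moreover have "real n * e * dot n v v \<le> dot n v (app n (mat_fun (K_tail_reg p lam \<psi> \<beta> \<gamma> n 0 x)) v)" for v
    unfolding e_def B_def by (intro K_reg_form_ge \<open>n \<ge> 1\<close> pd summ)
  ultimately obtain W where W: "mat_inverse (K_tail_reg p lam \<psi> \<beta> \<gamma> n 0 x) = Some W"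
    "W * K_tail_reg p lam \<psi> \<beta> \<gamma> n 0 x = 1\<^sub>m n" "W \<in> carrier_mat n n"
    by (rule mat_inverse_exists[OF K_tail_reg_carrier])
  define R where "R = rho_coeff p lam \<psi> \<beta> \<gamma> n k x"
  have R_eq: "R = (S + ennreal (eig 1 B) + ennreal \<gamma>) / ennreal e"
    using e0 by (simp add: R_def rho_coeff_def frac_inf_def Let_def S_def B_def e_def)
  have "ennreal ((p (Suc k))\<^sup>2 * lam (Suc k) powr \<beta>) \<le> S"
    unfolding S_def sup_tail_def by (rule SUP_upper) simp
  moreover have "0 < (p (Suc k))\<^sup>2 * lam (Suc k) powr \<beta>"
    using p[of "Suc k"] lam(1)[of "Suc k"] by simp
  ultimately have S0: "0 < S" by (metis ennreal_less_zero_iff less_le_trans)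
  \<comment> \<open>In \<open>ennreal\<close> zero times infinity is zero, so an infinite factor
    makes the right-hand side infinite only if the other factors are nonzero; this fact and
    \<open>T1_pos\<close> ensure that when \<open>\<sigma>\<close> is nonzero.\<close>
  have R0: "R \<noteq> 0" using S0 unfolding R_eq by (auto simp: ennreal_divide_eq_0_iff)
  have T1_pos: "T1 \<noteq> 0"
  proof (cases "\<mu> = 0")
    case True
    then show ?thesis by (simp add: T1_def frac_inf_def)
  next
    case False
    then have "0 < \<mu>" using eig_gram_nonneg[OF \<open>k \<ge> 1\<close>, of \<psi> n x] by (simp add: \<mu>_def)
    also have "\<mu> \<le> (\<Sum>j<n. (\<psi> 1 (x j))\<^sup>2)"
      unfolding \<mu>_def by (rule eig_gram_le_column) (use \<open>k \<ge> 1\<close> in simp)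
    finally have "0 < 1 / (p 1)\<^sup>2 * lam 1 powr (- \<beta>') * (\<Sum>j<n. (\<psi> 1 (x j))\<^sup>2)"
      using p[of 1] lam(1)[of 1] by simp
    also have "\<dots> = (\<Sum>j<n. 1 / (p 1)\<^sup>2 * lam 1 powr (- \<beta>') * (\<psi> 1 (x j))\<^sup>2)"
      by (simp add: sum_distrib_left)
    also have "\<dots> \<le> N1"
      unfolding N1_def
      by (intro sum_mono member_le_sum[of 1 _ "\<lambda>i. 1 / (p i)\<^sup>2 * lam i powr (- \<beta>') * (\<psi> i (x _))\<^sup>2"])
        (use \<open>k \<ge> 1\<close> in auto)
    finally show ?thesis
      using \<open>\<mu> \<noteq> 0\<close> by (simp add: T1_def frac_inf_def ennreal_divide_eq_0_iff)
  qed
  have "variance_term M eps \<rho> p lam \<psi> \<beta> \<beta>' \<gamma> n x \<le> ennreal (\<sigma>\<^sup>2) * R\<^sup>2 * (T1 + T2)"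
  \<comment> \<open>A singular Gram matrix falls under the last alternative, since
    \<open>\<mu> = 0\<close> makes \<open>T1\<close> infinite.\<close>
  proof (cases "\<sigma> = 0 \<or> S = \<top> \<or> T1 + T2 = \<top>")
    case True
    then consider "\<sigma> = 0" | "\<sigma> \<noteq> 0" "S = \<top>" | "\<sigma> \<noteq> 0" "T1 + T2 = \<top>" by blast
    then show ?thesis
    proof cases
      case 1
      have "variance_term M eps \<rho> p lam \<psi> \<beta> \<beta>' \<gamma> n x = 0"
        by (rule variance_term_noiseless[OF \<open>prob_space M\<close> \<open>prob_space \<rho>\<close> eps(1-3) _ basis lam \<open>0 \<le> \<beta>'\<close> W(1,3)])
          (use eps(4) 1 in auto)
      then show ?thesis by simp
    next
      case 2
      then have "R = \<top>" unfolding R_eq by (simp add: ennreal_top_divide)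
      then show ?thesis using 2 T1_pos by (simp add: ennreal_mult_eq_top_iff ennreal_top_mult power2_eq_square)
    next
      case 3
      then have "ennreal (\<sigma>\<^sup>2) * R\<^sup>2 * (T1 + T2) = \<top>"
        using R0 unfolding 3(2) by (simp add: ennreal_mult_top)
      then show ?thesis by simp
    qed
  next
    case False
    then have fin: "\<sigma> \<noteq> 0" "S \<noteq> \<top>" "T1 \<noteq> \<top>" "T2 \<noteq> \<top>" by auto
    obtain s where s: "S = ennreal s" "0 < s"
      using fin(2) S0 by (cases S) auto
    have \<mu>0: "\<mu> \<noteq> 0" using fin(3) by (auto simp: T1_def frac_inf_def)
    have denom: "(of_nat n)\<^sup>2 * S\<^sup>2 = ennreal ((real n)\<^sup>2 * s\<^sup>2)"
      using s by (simp add: ennreal_mult ennreal_power ennreal_of_nat_eq_real_of_nat)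
    have denom_pos: "0 < (real n)\<^sup>2 * s\<^sup>2" using s(2) \<open>n \<ge> 1\<close> by simp
    have f0: "0 \<le> f j m" for j m by (simp add: f_def)
    have swap: "(\<Sum>j<n. \<Sum>m. ennreal (f j m)) = (\<Sum>m. ennreal (\<Sum>j<n. f j m))"
      by (subst suminf_sum[symmetric]) (auto simp: f0 sum_ennreal)
    \<comment> \<open>A finite \<open>T2\<close> with a finite positive denominator forces a finite
      numerator; this yields the summability that the variance series requires.\<close>
    have "(\<Sum>m. ennreal (\<Sum>j<n. f j m)) \<noteq> \<top>"
    proof
      assume "(\<Sum>m. ennreal (\<Sum>j<n. f j m)) = \<top>"
      then have "T2 = \<top>"
        using denom_pos unfolding T2_def frac_inf_def swap denom by (simp add: ennreal_top_divide)
      then show False using fin(4) by simp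
    qed
    then have tail: "summable (\<lambda>m. \<Sum>j<n. f j m)"
      by (intro summable_suminf_not_top) (auto simp: f0 sum_nonneg)
    define N2 where "N2 = (\<Sum>m. \<Sum>j<n. f j m)"
    have N2: "0 \<le> N2" unfolding N2_def by (intro suminf_nonneg tail sum_nonneg f0)
    have T2: "T2 = ennreal (N2 / ((real n)\<^sup>2 * s\<^sup>2))"
    proof -
      have "(\<Sum>m. ennreal (\<Sum>j<n. f j m)) = ennreal N2"
        unfolding N2_def by (intro suminf_ennreal2 tail sum_nonneg f0)
      then show ?thesis
        using denom_pos N2 s(2) \<open>n \<ge> 1\<close> unfolding T2_def frac_inf_def swap denom by (simp add: divide_ennreal)
    qed
    have N1: "0 \<le> N1" unfolding N1_def by (intro sum_nonneg) simp
    have T1: "T1 = ennreal (N1 / \<mu>\<^sup>2)"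
      using \<mu>0 N1 by (simp add: T1_def frac_inf_def divide_ennreal)
    \<comment> \<open>\<open>ennreal\<close> sends negative reals to zero, so \<open>t\<close> is
      the real number that \<open>ennreal (eig 1 B)\<close> stands for, and it still dominates
      \<open>eig 1 B\<close>.\<close>
    define t where "t = max 0 (eig 1 B)"
    have t: "0 \<le> t" "eig 1 B \<le> t" "ennreal (eig 1 B) = ennreal t"
      by (simp_all add: t_def max_def ennreal_neg)
    define r where "r = (s + t + \<gamma>) / e"
    have R: "R = ennreal r"
      unfolding R_eq s(1) r_def t(3) using s(2) e0 t(1) \<open>\<gamma> \<ge> 0\<close>
      by (simp add: ennreal_plus[symmetric] divide_ennreal del: ennreal_plus)
    have r_ge: "(eig 1 B + \<gamma>) / e \<le> r" "s / e \<le> r"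
      unfolding r_def using e0 s(2) t \<open>\<gamma> \<ge> 0\<close> by (auto intro!: divide_right_mono)
    \<comment> \<open>With \<open>r\<close> at least one, the single power of the eigenvalue ratio
      in the head can be enlarged to \<open>r\<^sup>2\<close>.\<close>
    have "1 \<le> (eig 1 B + \<gamma>) / e"
      using eig_least_le_greatest[OF \<open>n \<ge> 1\<close> pd] e0 by (simp add: e_def B_def)
    then have r1: "1 \<le> r" using r_ge(1) by linarith
    have tail_eq: "(\<lambda>m. \<Sum>j<n. f j m) = (\<lambda>m. (p (k + Suc m))\<^sup>2 * lam (k + Suc m) powr (2 * \<beta> - \<beta>')
          * (\<Sum>j<n. (\<psi> (k + Suc m) (x j))\<^sup>2))"
      by (simp add: f_def sum_distrib_left)
    define g where "g = (\<lambda>i. (p i)\<^sup>2 * lam i powr (2 * \<beta> - \<beta>') * (\<Sum>l<n. (\<Sum>j<n. W $$ (j, l) * \<psi> i (x j))\<^sup>2))"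
    note series = variance_series_bound[OF \<open>n \<ge> 1\<close> \<open>k \<ge> 1\<close> pd summ p lam(1) W(3,2)
        tail[unfolded tail_eq] \<mu>0[unfolded \<mu>_def]]
    have g_summable: "summable (\<lambda>m. g (Suc m))"
      unfolding g_def by (rule series(1))
    have full: "summable (\<lambda>m. (p (Suc m))\<^sup>2 * lam (Suc m) powr (2 * \<beta> - \<beta>') * (\<Sum>j<n. (\<psi> (Suc m) (x j))\<^sup>2))"
      using tail unfolding tail_eq
      by (subst summable_iff_shift[symmetric, of _ k]) (simp add: add.commute)
    have "variance_term M eps \<rho> p lam \<psi> \<beta> \<beta>' \<gamma> n x = (\<Sum>m. ennreal (\<sigma>\<^sup>2 * g (Suc m)))"
      unfolding g_def
      by (rule variance_term_eq[OF \<open>prob_space M\<close> \<open>prob_space \<rho>\<close> assms(8) eps basis lam \<open>0 \<le> \<beta>'\<close> W(1,3) full])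
    also have "\<dots> = ennreal (\<sigma>\<^sup>2 * (\<Sum>m. g (Suc m)))"
    proof -
      have "0 \<le> g i" for i unfolding g_def by (intro mult_nonneg_nonneg sum_nonneg) simp_all
      then show ?thesis
        using summable_mult[OF g_summable, of "\<sigma>\<^sup>2"]
        by (subst suminf_ennreal2) (simp_all add: suminf_mult[OF g_summable])
    qed
    also have "\<dots> \<le> ennreal (\<sigma>\<^sup>2 * (r\<^sup>2 * (N1 / \<mu>\<^sup>2 + N2 / ((real n)\<^sup>2 * s\<^sup>2))))"
    proof (intro ennreal_leI mult_left_mono)
      have "(\<Sum>m. g (Suc m)) \<le> (eig 1 B + \<gamma>) / e * (N1 / \<mu>\<^sup>2) + N2 / (real n * e)\<^sup>2"
        unfolding g_def N1_def N2_def tail_eq e_def B_def \<mu>_def by (rule series(2))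
      also have "(eig 1 B + \<gamma>) / e * (N1 / \<mu>\<^sup>2) \<le> r\<^sup>2 * (N1 / \<mu>\<^sup>2)"
      proof (rule mult_right_mono)
        have "r * 1 \<le> r * r" using r1 by (intro mult_left_mono) auto
        then show "(eig 1 B + \<gamma>) / e \<le> r\<^sup>2" using r_ge(1) by (simp add: power2_eq_square)
      qed (use N1 in simp)
      \<comment> \<open>Expanding by \<open>s\<^sup>2\<close> creates the tail denominator; the
        remaining \<open>s / e\<close> is at most \<open>r\<close>, the supremum being a summand of
        the numerator of \<open>r\<close>.\<close>
      also have "N2 / (real n * e)\<^sup>2 = (s / e)\<^sup>2 * (N2 / ((real n)\<^sup>2 * s\<^sup>2))"
        using s(2) by (simp add: power_mult_distrib power_divide)
      also have "\<dots> \<le> r\<^sup>2 * (N2 / ((real n)\<^sup>2 * s\<^sup>2))"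
        using r_ge(2) s(2) e0 N2 by (intro mult_right_mono power_mono) auto
      finally show "(\<Sum>m. g (Suc m)) \<le> r\<^sup>2 * (N1 / \<mu>\<^sup>2 + N2 / ((real n)\<^sup>2 * s\<^sup>2))"
        by (simp add: distrib_left)
    qed simp
    also have "\<dots> = ennreal (\<sigma>\<^sup>2) * R\<^sup>2 * (T1 + T2)"
      unfolding R T1 T2 using r1 N1 N2
      by (simp add: ennreal_mult ennreal_power mult.assoc flip: ennreal_plus)
    finally show ?thesis .
  qed
  then show "variance_term M eps \<rho> p lam \<psi> \<beta> \<beta>' \<gamma> n (\<lambda>j. X j \<omega>)
        \<le> ennreal (\<sigma>\<^sup>2) * (rho_coeff p lam \<psi> \<beta> \<gamma> n k (\<lambda>j. X j \<omega>))\<^sup>2 *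
          (frac_inf
             (ennreal (\<Sum>j<n. \<Sum>i=1..k. 1 / (p i)\<^sup>2 * lam i powr (- \<beta>') * (\<psi> i (X j \<omega>))\<^sup>2))
             (ennreal ((eig k (transpose_mat (Psi_le \<psi> n k (\<lambda>j. X j \<omega>)) * Psi_le \<psi> n k (\<lambda>j. X j \<omega>)))\<^sup>2))
           + frac_inf
             (\<Sum>j<n. \<Sum>m. ennreal ((p (k + Suc m))\<^sup>2 * lam (k + Suc m) powr (2 * \<beta> - \<beta>')
                * (\<psi> (k + Suc m) (X j \<omega>))\<^sup>2))
             ((of_nat n)\<^sup>2 * (sup_tail p lam \<beta> k)\<^sup>2))"
    unfolding x_def R_def T1_def T2_def N1_def \<mu>_def f_def S_def .
qed

end
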